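(* Let $H$ be a linear cycle set, $I$ a trivial linear cycle set, and $\diamond\colon H\times I\to I$, $\leftthreetimes\colon I\times H\to I$ maps such that for all $h,h'\in H$ and $y,y'\in I$: $h\diamond(y+y')=h\diamond y+h\diamond y'$; $0\diamond y=y$; $0\leftthreetimes h=0$; $y\leftthreetimes0=0$; $y\leftthreetimes(h+h')=y\leftthreetimes h+y\leftthreetimes h'$; $(y+y')\leftthreetimes h=y\leftthreetimes h+y'\leftthreetimes h$; $(h+h')\diamond y=(h\cdot h')\diamond(h\diamond y)$; $(h\diamond y)\leftthreetimes(h\cdot h')=h\diamond(y\leftthreetimes h')+\bigl(h\diamond(y\leftthreetimes h)\bigr)\leftthreetimes(h\cdot h')$; and the maps $y\mapsto h\diamond y$ are permutations of $I$. Then $(\widehat C_N^*(H,I),\partial+D)$ is a cochain complex, that is, $(\partial+D)\circ(\partial+D)=0$.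
   Context: A linear cycle set is an abelian group $(A,+)$ with a binary operation $\cdot$ such that for each $b\in A$ the map $a\mapsto b\cdot a$ is bijective, and $a\cdot(b+c)=a\cdot b+a\cdot c$ and $(a+b)\cdot c=(a\cdot b)\cdot(a\cdot c)$ for all $a,b,c$. It is trivial if $a\cdot b=b$ for all $a,b$. Let $\overline H=H\setminus\{0\}$. For $s\ge1$ let $\mathbb Z[\overline H^s]$ be the free abelian group on $\overline H^s$ (and $\mathbb Z[\overline H^0]=\mathbb Z$), and let $\mathrm{sh}(\mathbb Z[\overline H^s])$ be the subgroup generated by the shuffles $\sum_{\sigma\in\mathrm{sh}_{l,s-l}}\mathrm{sg}(\sigma)(h_{\sigma^{-1}(1)},\dots,h_{\sigma^{-1}(s)})$, for $1\le l<s$ and $h_k\in\overline H$, where $\mathrm{sh}_{l,s-l}$ is the set of permutations $\sigma$ of $\{1,\dots,s\}$ with $\sigma(1)<\dots<\sigma(l)$ and $\sigma(l+1)<\dots<\sigma(s)$. Put $\overline M(s)=\mathbb Z[\overline H^s]/\mathrm{sh}(\mathbb Z[\overline H^s])$ and denote by $[h_1,\dots,h_s]$ the class of $(h_1,\dots,h_s)$. For $r\ge0$, $s\ge1$ let $\widehat C_N^{rs}(H,I)=\mathrm{Hom}(\mathbb Z[\overline H^r]\otimes\overline M(s),I)$. We write $f(h_1,\dots,h_r,[h_{r+1},\dots,h_{r+s}])$ for the value of $f$ on $(h_1,\dots,h_r)\otimes[h_{r+1},\dots,h_{r+s}]$; by convention this value is $0$ if some $h_i=0$. For $r\ge0$,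 $s\ge1$ let $R_{rs}(h_1,\dots,h_{r+s})=(h_1+\dots+h_r)\cdot(h_{r+1}+\dots+h_{r+s})\in H$. The maps $\partial_{\mathrm h}^{r+1,s}\colon\widehat C_N^{rs}(H,I)\to\widehat C_N^{r+1,s}(H,I)$, $\partial_{\mathrm v}^{r,s+1}\colon\widehat C_N^{rs}(H,I)\to\widehat C_N^{r,s+1}(H,I)$ and $D_{rs}^{r+s,1}\colon\widehat C_N^{rs}(H,I)\to\widehat C_N^{r+s,1}(H,I)$ are \begin{align*} \partial_{\mathrm h}^{r+1,s}(f)(h_1,\dots,h_{r+1},[h_{r+2},\dots,h_{r+s+1}])&=f(h_1\cdot h_2,\dots,h_1\cdot h_{r+1},[h_1\cdot h_{r+2},\dots,h_1\cdot h_{r+s+1}])\\ &+\sum_{j=1}^r(-1)^jf(h_1,\dots,h_{j-1},h_j+h_{j+1},h_{j+2},\dots,h_{r+1},[h_{r+2},\dots,h_{r+s+1}])\\ &+(-1)^{r+1}R_{r1}(h_1,\dots,h_{r+1})\diamond f(h_1,\dots,h_r,[h_{r+2},\dots,h_{r+s+1}]),\\ \partial_{\mathrm v}^{r,s+1}(f)(h_1,\dots,h_r,[h_{r+1},\dots,h_{r+s+1}])&=(-1)^rf(h_1,\dots,h_r,[h_{r+2},\dots,h_{r+s+1}])\\ &+\sum_{j=r+1}^{r+s}(-1)^jf(h_1,\dots,h_r,[h_{r+1},\dots,h_{j-1},h_j+h_{j+1},h_{j+2},\dots,h_{r+s+1}])\\ &+(-1)^{r+s+1}f(h_1,\dots,h_r,[h_{r+1},\dots,h_{r+s}]),\\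 D_{rs}^{r+s,1}(f)(h_1,\dots,h_{r+s},[h_{r+s+1}])&=(-1)^{r+s}\bigl(R_{rs}(h_1,\dots,h_{r+s})\diamond f(h_1,\dots,h_r,[h_{r+1},\dots,h_{r+s}])\bigr)\leftthreetimes R_{r+s,1}(h_1,\dots,h_{r+s+1}). \end{align*} For $n\ge1$, $\widehat C_N^n(H,I)=\bigoplus_{r=0}^{n-1}\widehat C_N^{r,n-r}(H,I)$. The degree-one maps $\partial$ and $D$ on $\widehat C_N^*(H,I)$ are $\partial=\partial_{\mathrm h}+\partial_{\mathrm v}$ and $D(f_{0n},\dots,f_{n-1,1})=\sum_{k=1}^nD_{n-k,k}^{n1}(f_{n-k,k})$. *)

theory Defs
  imports
    "HOL-Algebra.Free_Abelian_Groups"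
    "HOL-Combinatorics.Permutations"
begin

text \<open>
  Linear cycle sets are carried by types of class \<open>ab_group_add\<close>. The groups built from them
  (free abelian groups, quotients, tensor products, groups of homomorphisms, direct sums) are
  HOL-Algebra records, written multiplicatively.
\<close>

locale linear_cycle_set =
  fixes dot :: "'a::ab_group_add \<Rightarrow> 'a \<Rightarrow> 'a"
  assumes bij_dot: "bij (\<lambda>a. dot b a)"
    and dot_add_right: "dot a (b + c) = dot a b + dot a c"
    and dot_add_left: "dot (a + b) c = dot (dot a b) (dot a c)"

locale trivial_linear_cycle_set = linear_cycle_set dot
  for dot :: "'a::ab_group_add \<Rightarrow> 'a \<Rightarrow> 'a" +
  assumes dot_trivial: "dot a b = b"


subsection \<open>Abelian groups\<close>

definition additive_group :: "'a::ab_group_add monoid"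
  where "additive_group = \<lparr>carrier = UNIV, monoid.mult = (+), one = 0\<rparr>"

definition quotient_class :: "('a, 'm) monoid_scheme \<Rightarrow> 'a set \<Rightarrow> 'a \<Rightarrow> 'a set"
  where "quotient_class G N x = N #>\<^bsub>G\<^esub> x"

definition tensor_relations ::
    "('a, 'm) monoid_scheme \<Rightarrow> ('b, 'n) monoid_scheme \<Rightarrow> ('a \<times> 'b \<Rightarrow>\<^sub>0 int) set"
  where "tensor_relations A B =
    {frag_of (a \<otimes>\<^bsub>A\<^esub> a', b) - frag_of (a, b) - frag_of (a', b) | a a' b.
        a \<in> carrier A \<and> a' \<in> carrier A \<and> b \<in> carrier B} \<union>
    {frag_of (a, b \<otimes>\<^bsub>B\<^esub> b') - frag_of (a, b) - frag_of (a, b') | a b b'.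
        a \<in> carrier A \<and> b \<in> carrier B \<and> b' \<in> carrier B}"

definition tensor_subgroup ::
    "('a, 'm) monoid_scheme \<Rightarrow> ('b, 'n) monoid_scheme \<Rightarrow> ('a \<times> 'b \<Rightarrow>\<^sub>0 int) set"
  where "tensor_subgroup A B =
    generate (free_Abelian_group (carrier A \<times> carrier B)) (tensor_relations A B)"

text \<open>The tensor product over the integers of two abelian groups.\<close>

definition tensor_product ::
    "('a, 'm) monoid_scheme \<Rightarrow> ('b, 'n) monoid_scheme \<Rightarrow> ('a \<times> 'b \<Rightarrow>\<^sub>0 int) set monoid"
  where "tensor_product A B =
    free_Abelian_group (carrier A \<times> carrier B) Mod tensor_subgroup A B"

definition pure_tensor ::
    "('a, 'm) monoid_scheme \<Rightarrow> ('b, 'n) monoid_scheme \<Rightarrow> 'a \<Rightarrow> 'b \<Rightarrow> ('a \<times> 'b \<Rightarrow>\<^sub>0 int) set"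
  where "pure_tensor A B a b =
    quotient_class (free_Abelian_group (carrier A \<times> carrier B)) (tensor_subgroup A B)
      (frag_of (a, b))"

text \<open>
  Homomorphisms are taken extensional (\<open>undefined\<close> off the carrier), so that elements of the group
  are determined by their values on the carrier.
\<close>

definition Hom_group ::
    "('a, 'm) monoid_scheme \<Rightarrow> ('b, 'n) monoid_scheme \<Rightarrow> ('a \<Rightarrow> 'b) monoid"
  where "Hom_group G K =
    \<lparr>carrier = hom G K \<inter> extensional (carrier G),
     monoid.mult = (\<lambda>f g. \<lambda>x\<in>carrier G. f x \<otimes>\<^bsub>K\<^esub> g x),
     one = (\<lambda>x\<in>carrier G. \<one>\<^bsub>K\<^esub>)\<rparr>"


subsection \<open>Cochain groups\<close>

definition nz_tuples :: "nat \<Rightarrow> 'h::zero list set"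
  where "nz_tuples s = {hs. length hs = s \<and> 0 \<notin> set hs}"

definition shuffle_perms :: "nat \<Rightarrow> nat \<Rightarrow> (nat \<Rightarrow> nat) set"
  where "shuffle_perms l s =
    {\<sigma>. \<sigma> permutes {1..s} \<and> strict_mono_on {1..l} \<sigma> \<and> strict_mono_on {l+1..s} \<sigma>}"

definition shuffle_sum :: "nat \<Rightarrow> 'h list \<Rightarrow> 'h list \<Rightarrow>\<^sub>0 int"
  where "shuffle_sum l hs =
    (\<Sum>\<sigma>\<in>shuffle_perms l (length hs).
        frag_cmul (sign \<sigma>) (frag_of (map (\<lambda>i. hs ! (inv_into UNIV \<sigma> i - 1)) [1..<length hs + 1])))"

definition free_tuples :: "nat \<Rightarrow> ('h::zero list \<Rightarrow>\<^sub>0 int) monoid"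
  where "free_tuples s = free_Abelian_group (nz_tuples s)"

definition shuffle_subgroup :: "nat \<Rightarrow> ('h::zero list \<Rightarrow>\<^sub>0 int) set"
  where "shuffle_subgroup s =
    generate (free_tuples s) {shuffle_sum l hs | l hs. 1 \<le> l \<and> l < s \<and> hs \<in> nz_tuples s}"

text \<open>The group \<open>M(s)\<close> of tuples modulo shuffles, and the class \<open>[h\<^sub>1, \<dots>, h\<^sub>s]\<close> of a tuple.\<close>

definition M_group :: "nat \<Rightarrow> ('h::zero list \<Rightarrow>\<^sub>0 int) set monoid"
  where "M_group s = free_tuples s Mod shuffle_subgroup s"

definition M_class :: "'h::zero list \<Rightarrow> ('h list \<Rightarrow>\<^sub>0 int) set"
  where "M_class ks =
    quotient_class (free_tuples (length ks)) (shuffle_subgroup (length ks)) (frag_of ks)"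

type_synonym 'h chain = "(('h list \<Rightarrow>\<^sub>0 int) \<times> ('h list \<Rightarrow>\<^sub>0 int) set \<Rightarrow>\<^sub>0 int) set"

definition C_bigr :: "nat \<Rightarrow> nat \<Rightarrow> ('h::zero chain \<Rightarrow> 'i::ab_group_add) monoid"
  where "C_bigr r s = Hom_group (tensor_product (free_tuples r) (M_group s)) additive_group"

text \<open>\<open>value_at f [h\<^sub>1, \<dots>, h\<^sub>r] [h\<^sub>r\<^sub>+\<^sub>1, \<dots>, h\<^sub>r\<^sub>+\<^sub>s]\<close> is \<open>f(h\<^sub>1, \<dots>, h\<^sub>r, [h\<^sub>r\<^sub>+\<^sub>1, \<dots>, h\<^sub>r\<^sub>+\<^sub>s])\<close>, with the
  convention that it is \<open>0\<close> as soon as some entry is \<open>0\<close>.\<close>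

definition value_at ::
    "('h::zero chain \<Rightarrow> 'i::ab_group_add) \<Rightarrow> 'h list \<Rightarrow> 'h list \<Rightarrow> 'i"
  where "value_at f hs ks =
    (if 0 \<in> set hs \<or> 0 \<in> set ks then 0
     else f (pure_tensor (free_tuples (length hs)) (M_group (length ks))
               (frag_of hs) (M_class ks)))"

text \<open>The element of \<open>C_bigr r s\<close> with prescribed values on the generators
  \<open>(h\<^sub>1, \<dots>, h\<^sub>r) \<otimes> [h\<^sub>r\<^sub>+\<^sub>1, \<dots>, h\<^sub>r\<^sub>+\<^sub>s]\<close>. It is unique if it exists; it exists if
  \<open>F hs\<close> respects the shuffle relations.\<close>

definition cochain_with_values ::
    "nat \<Rightarrow> nat \<Rightarrow> ('h::zero list \<Rightarrow> 'h list \<Rightarrow> 'i) \<Rightarrow> 'h chain \<Rightarrow> 'i::ab_group_add"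
  where "cochain_with_values r s F =
    (THE g. g \<in> carrier (C_bigr r s) \<and>
       (\<forall>hs\<in>nz_tuples r. \<forall>ks\<in>nz_tuples s. value_at g hs ks = F hs ks))"

definition C_total :: "nat \<Rightarrow> (nat \<Rightarrow> 'h::zero chain \<Rightarrow> 'i::ab_group_add) monoid"
  where "C_total n = sum_group {0..<n} (\<lambda>r. C_bigr r (n - r))"


subsection \<open>The differentials\<close>

text \<open>\<open>alt k x\<close> is \<open>(-1)\<^sup>k x\<close>.\<close>

definition alt :: "nat \<Rightarrow> 'i::ab_group_add \<Rightarrow> 'i"
  where "alt k x = (if even k then x else - x)"

text \<open>\<open>merge j [h\<^sub>1, \<dots>, h\<^sub>n]\<close> is \<open>[h\<^sub>1, \<dots>, h\<^sub>j + h\<^sub>j\<^sub>+\<^sub>1, \<dots>, h\<^sub>n]\<close>, for \<open>1 \<le> j < n\<close>.\<close>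

definition merge :: "nat \<Rightarrow> 'h::plus list \<Rightarrow> 'h list"
  where "merge j hs = take (j - 1) hs @ [hs ! (j - 1) + hs ! j] @ drop (j + 1) hs"

text \<open>\<open>R_map dot [h\<^sub>1, \<dots>, h\<^sub>r] [h\<^sub>r\<^sub>+\<^sub>1, \<dots>, h\<^sub>r\<^sub>+\<^sub>s]\<close> is \<open>R\<^sub>r\<^sub>s(h\<^sub>1, \<dots>, h\<^sub>r\<^sub>+\<^sub>s)\<close>.\<close>

definition R_map :: "('h::ab_group_add \<Rightarrow> 'h \<Rightarrow> 'h) \<Rightarrow> 'h list \<Rightarrow> 'h list \<Rightarrow> 'h"
  where "R_map dot hs ks = dot (sum_list hs) (sum_list ks)"

text \<open>
  In the three definitions below the indices \<open>r s\<close> are those of the source \<open>C_bigr r s\<close>, the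
  operation \<open>dia\<close> is the left action of \<open>H\<close> on \<open>I\<close> and \<open>lt\<close> the right operation of \<open>H\<close> on \<open>I\<close>.
\<close>

definition d_hor ::
    "('h::ab_group_add \<Rightarrow> 'h \<Rightarrow> 'h) \<Rightarrow> ('h \<Rightarrow> 'i \<Rightarrow> 'i) \<Rightarrow> nat \<Rightarrow> nat \<Rightarrow>
     ('h chain \<Rightarrow> 'i) \<Rightarrow> 'h chain \<Rightarrow> 'i::ab_group_add"
  where "d_hor dot dia r s f = cochain_with_values (r + 1) s (\<lambda>hs ks.
      value_at f (map (dot (hd hs)) (tl hs)) (map (dot (hd hs)) ks)
    + (\<Sum>j\<in>{1..r}. alt j (value_at f (merge j hs) ks))
    + alt (r + 1) (dia (R_map dot (take r hs) (drop r hs)) (value_at f (take r hs) ks)))"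

text \<open>The tuple \<open>ks = [h\<^sub>r\<^sub>+\<^sub>1, \<dots>, h\<^sub>r\<^sub>+\<^sub>s\<^sub>+\<^sub>1]\<close> has \<open>h\<^sub>j\<close> in position \<open>j - r\<close>, counting from \<open>1\<close>.\<close>

definition d_ver ::
    "nat \<Rightarrow> nat \<Rightarrow> ('h::ab_group_add chain \<Rightarrow> 'i) \<Rightarrow> 'h chain \<Rightarrow> 'i::ab_group_add"
  where "d_ver r s f = cochain_with_values r (s + 1) (\<lambda>hs ks.
      alt r (value_at f hs (tl ks))
    + (\<Sum>j\<in>{r+1..r+s}. alt j (value_at f hs (merge (j - r) ks)))
    + alt (r + s + 1) (value_at f hs (butlast ks)))"

definition D_comp ::
    "('h::ab_group_add \<Rightarrow> 'h \<Rightarrow> 'h) \<Rightarrow> ('h \<Rightarrow> 'i \<Rightarrow> 'i) \<Rightarrow> ('i \<Rightarrow> 'h \<Rightarrow> 'i) \<Rightarrow> nat \<Rightarrow> nat \<Rightarrow>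
     ('h chain \<Rightarrow> 'i) \<Rightarrow> 'h chain \<Rightarrow> 'i::ab_group_add"
  where "D_comp dot dia lt r s f = cochain_with_values (r + s) 1 (\<lambda>hs ks.
      lt (alt (r + s) (dia (R_map dot (take r hs) (drop r hs))
                           (value_at f (take r hs) (drop r hs))))
         (R_map dot hs ks))"

text \<open>The degree-one maps from \<open>C_total n\<close> to \<open>C_total (n + 1)\<close>.\<close>

definition d_total ::
    "('h::ab_group_add \<Rightarrow> 'h \<Rightarrow> 'h) \<Rightarrow> ('h \<Rightarrow> 'i \<Rightarrow> 'i) \<Rightarrow> nat \<Rightarrow>
     (nat \<Rightarrow> 'h chain \<Rightarrow> 'i) \<Rightarrow> nat \<Rightarrow> 'h chain \<Rightarrow> 'i::ab_group_add"
  where "d_total dot dia n f = (\<lambda>r\<in>{0..<n+1}.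
      (if 1 \<le> r then d_hor dot dia (r - 1) (n + 1 - r) (f (r - 1))
       else \<one>\<^bsub>C_bigr r (n + 1 - r)\<^esub>)
      \<otimes>\<^bsub>C_bigr r (n + 1 - r)\<^esub>
      (if r < n then d_ver r (n - r) (f r) else \<one>\<^bsub>C_bigr r (n + 1 - r)\<^esub>))"

definition D_total ::
    "('h::ab_group_add \<Rightarrow> 'h \<Rightarrow> 'h) \<Rightarrow> ('h \<Rightarrow> 'i \<Rightarrow> 'i) \<Rightarrow> ('i \<Rightarrow> 'h \<Rightarrow> 'i) \<Rightarrow> nat \<Rightarrow>
     (nat \<Rightarrow> 'h chain \<Rightarrow> 'i) \<Rightarrow> nat \<Rightarrow> 'h chain \<Rightarrow> 'i::ab_group_add"
  where "D_total dot dia lt n f = (\<lambda>r\<in>{0..<n+1}.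
      if r = n
      then finprod (C_bigr n 1) (\<lambda>k. D_comp dot dia lt (n - k) k (f (n - k))) {1..n}
      else \<one>\<^bsub>C_bigr r (n + 1 - r)\<^esub>)"

definition total_diff ::
    "('h::ab_group_add \<Rightarrow> 'h \<Rightarrow> 'h) \<Rightarrow> ('h \<Rightarrow> 'i \<Rightarrow> 'i) \<Rightarrow> ('i \<Rightarrow> 'h \<Rightarrow> 'i) \<Rightarrow> nat \<Rightarrow>
     (nat \<Rightarrow> 'h chain \<Rightarrow> 'i) \<Rightarrow> nat \<Rightarrow> 'h chain \<Rightarrow> 'i::ab_group_add"
  where "total_diff dot dia lt n f =
    d_total dot dia n f \<otimes>\<^bsub>C_total (n + 1)\<^esub> D_total dot dia lt n f"

text \<open>Cochain complexes concentrated in degrees \<open>\<ge> 1\<close>.\<close>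

definition is_cochain_complex :: "(nat \<Rightarrow> ('a, 'm) monoid_scheme) \<Rightarrow> (nat \<Rightarrow> 'a \<Rightarrow> 'a) \<Rightarrow> bool"
  where "is_cochain_complex C d \<longleftrightarrow>
    (\<forall>n\<ge>1. comm_group (C n)) \<and>
    (\<forall>n\<ge>1. d n \<in> hom (C n) (C (n + 1))) \<and>
    (\<forall>n\<ge>1. \<forall>f\<in>carrier (C n). d (n + 1) (d n f) = \<one>\<^bsub>C (n + 2)\<^esub>)"

end

theory Submission
  imports Defs "HOL.Modules"
begin

text \<open>
  The vertical differential respects the shuffle relations because the bar differential is a graded
  derivation of the shuffle product. For the identity \<open>(\<partial> + D)\<^sup>2 = 0\<close>, replace \<open>f\<close> by the twisted cochain
  \<open>(h\<^sub>1 + \<dots> + h\<^sub>r)\<^sup>-\<^sup>1 \<diamondop> f(h\<^sub>1, \<dots>, h\<^sub>r, [\<dots>])\<close>. This removes the action from the last face of \<open>\<partial>\<^sub>h\<close>, so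
  that \<open>\<partial>\<close> becomes an ordinary double complex of bar type. After twisting, \<open>D f(h\<^sub>1, \<dots>, h\<^sub>n, [k])\<close> is
  \<open>\<plusminus>\<theta>\<^sub>S\<^sub>,\<^sub>k(T f)\<close> with \<open>S = h\<^sub>1 + \<dots> + h\<^sub>n\<close>, where \<open>T f\<close> sums \<open>f\<close> over all ways to cut \<open>(h\<^sub>1, \<dots>, h\<^sub>n)\<close> in two and
  \<open>\<theta>\<^sub>S\<^sub>,\<^sub>k\<close> is additive and additive in \<open>k\<close>. Additivity in \<open>k\<close> kills \<open>\<partial>\<^sub>v D\<close>; in \<open>T \<partial> f\<close> the terms that do
  not come from the bar faces of the whole tuple cancel; and \<open>\<partial>\<^sub>h D + D \<partial> + D D\<close> vanishes by
  \<open>\<theta>\<^bsub>S+h,k\<^esub>(y - \<theta>\<^bsub>S,h\<^esub> y) = \<theta>\<^bsub>S,k\<^esub> y\<close>, which follows from \<open>\<theta>\<^bsub>S,k\<^esub>(y - y \<leftthreetimes> S) = y \<leftthreetimes> k\<close> and the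
  surjectivity of \<open>y \<mapsto> y - y \<leftthreetimes> S\<close>.
\<close>

section \<open>The bar differential and shuffles\<close>

lemma alt_0 [simp]: "alt 0 x = x" and alt_Suc [simp]: "alt (Suc n) x = - alt n x"
  and alt_zero [simp]: "alt n 0 = 0"
  by (auto simp: alt_def)

lemma alt_add: "alt n (x + y) = alt n x + alt n y"
  and alt_minus: "alt n (- x) = - alt n x"
  and alt_diff: "alt n (x - y) = alt n x - alt n y"
  and alt_alt: "alt m (alt n x) = alt (m + n) x"
  by (auto simp: alt_def)

lemma alt_sum: "alt n (sum f A) = (\<Sum>x\<in>A. alt n (f x))"
  by (auto simp: alt_def sum_negf)

lemma (in additive) alt: "f (alt n x) = alt n (f x)"
  by (auto simp: alt_def minus)

text \<open>
  On \<open>[h\<^sub>1, \<dots>, h\<^sub>n]\<close> this is \<open>\<Sum>\<^sub>j (-1)\<^sup>j f(\<dots>, h\<^sub>j + h\<^sub>j\<^sub>+\<^sub>1, \<dots>) + (-1)\<^sup>n f(h\<^sub>1, \<dots>, h\<^sub>n\<^sub>-\<^sub>1)\<close>: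
  the part of the bar differential that does not involve an action. Both the horizontal and the
  vertical differential are this plus a first face.
\<close>

fun bar_tail :: "('h::ab_group_add list \<Rightarrow> 'i::ab_group_add) \<Rightarrow> 'h list \<Rightarrow> 'i" where
  "bar_tail f [] = 0"
| "bar_tail f [x] = - f []"
| "bar_tail f (x # y # zs) = - f ((x + y) # zs) - bar_tail (\<lambda>w. f (x # w)) (y # zs)"

text \<open>The inhomogeneous bar differential of the additive group H with trivial coefficients; up
  to a sign it is the vertical differential.\<close>

fun bar_diff :: "('h::ab_group_add list \<Rightarrow> 'i::ab_group_add) \<Rightarrow> 'h list \<Rightarrow> 'i" where
  "bar_diff f [] = 0"
| "bar_diff f (x # xs) = f xs + bar_tail f (x # xs)"

lemma bar_tail_cong:
  assumes "\<And>w. Suc (length w) = length zs \<Longrightarrow> f w = g w"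
  shows "bar_tail f zs = bar_tail g zs"
  using assms by (induction f zs arbitrary: g rule: bar_tail.induct) auto

lemma bar_diff_cong:
  assumes "\<And>w. Suc (length w) = length zs \<Longrightarrow> f w = g w"
  shows "bar_diff f zs = bar_diff g zs"
  using assms by (cases zs) (auto intro: bar_tail_cong)

lemma bar_tail_add: "bar_tail (\<lambda>w. f w + g w) zs = bar_tail f zs + bar_tail g zs"
  by (induction f zs arbitrary: g rule: bar_tail.induct) auto

lemma bar_tail_zero [simp]: "bar_tail (\<lambda>w. 0) zs = 0"
  by (induction zs rule: induct_list012) auto

lemma bar_tail_additive:
  assumes "additive p"
  shows "bar_tail (\<lambda>w. p (f w)) zs = p (bar_tail f zs)"
  by (induction f zs rule: bar_tail.induct)
     (auto simp: additive.zero[OF assms] additive.minus[OF assms] additive.diff[OF assms])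

lemma bar_tail_map:
  assumes "additive q"
  shows "bar_tail f (map q zs) = bar_tail (\<lambda>w. f (map q w)) zs"
  by (induction "\<lambda>w. f (map q w)" zs arbitrary: f rule: bar_tail.induct)
     (auto simp: additive.add[OF assms])

lemma additive_uminus: "additive (uminus :: 'i::ab_group_add \<Rightarrow> 'i)"
  and additive_alt: "additive (alt n :: 'i::ab_group_add \<Rightarrow> 'i)"
  by (unfold_locales) (auto simp: alt_add)

lemma bar_tail_uminus: "bar_tail (\<lambda>w. - f w) zs = - bar_tail f zs"
  by (rule bar_tail_additive[OF additive_uminus])

lemma bar_tail_diff: "bar_tail (\<lambda>w. f w - g w) zs = bar_tail f zs - bar_tail g zs"
  using bar_tail_add[of f "\<lambda>w. - g w" zs] by (simp add: bar_tail_uminus)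

lemma bar_diff_add: "bar_diff (\<lambda>w. f w + g w) zs = bar_diff f zs + bar_diff g zs"
  by (cases zs) (auto simp: bar_tail_add)

lemma bar_diff_zero [simp]: "bar_diff (\<lambda>w. 0) zs = 0"
  by (cases zs) auto

lemma bar_diff_additive:
  assumes "additive p"
  shows "bar_diff (\<lambda>w. p (f w)) zs = p (bar_diff f zs)"
  using assms by (cases zs) (auto simp: bar_tail_additive additive.add additive.zero)

lemma bar_diff_map:
  assumes "additive q"
  shows "bar_diff f (map q zs) = bar_diff (\<lambda>w. f (map q w)) zs"
  using bar_tail_map[OF assms, of f zs] by (cases zs) auto

text \<open>By associativity, x can be merged into the head after a face of \<open>y # zs\<close>
  instead of before it. The branch \<open>[]\<close> records the deletion of the only letter
  left.\<close>

lemma bar_tail_merge_first: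
  "bar_tail f ((x + y) # zs) = bar_tail (\<lambda>w. case w of [] \<Rightarrow> f [] | v # vs \<Rightarrow> f ((x + v) # vs)) (y # zs)"
  by (cases zs) (auto simp: add.assoc)

text \<open>Induction on the first letter. The inner \<open>bar_tail\<close> at \<open>x # w\<close>
  consists of the merge of x with the head of w and of the faces behind x. The latter vanish by
  induction; the former cancel the outer merge x + y by \<open>bar_tail_merge_first\<close>.\<close>

lemma bar_tail_bar_tail [simp]:
  fixes f :: "'h::ab_group_add list \<Rightarrow> 'i::ab_group_add"
  shows "bar_tail (bar_tail f) zs = 0"
proof (induction f zs rule: bar_tail.induct)
  case (3 f x y zs)
  show ?case
  proof (cases zs)
    case (Cons z zs')
    have "bar_tail (\<lambda>w. bar_tail f (x # w)) (y # zs)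
      = bar_tail (\<lambda>w. - (case w of [] \<Rightarrow> f [] | v # vs \<Rightarrow> f ((x + v) # vs)) - bar_tail (\<lambda>u. f (x # u)) w) (y # zs)"
    proof (rule bar_tail_cong)
      fix w :: "'h list" assume "Suc (length w) = length (y # zs)"
      then show "bar_tail f (x # w) = - (case w of [] \<Rightarrow> f [] | v # vs \<Rightarrow> f ((x + v) # vs)) - bar_tail (\<lambda>u. f (x # u)) w"
        using Cons by (cases w) auto
    qed
    also have "\<dots> = - bar_tail f ((x + y) # zs)"
      by (simp only: bar_tail_diff bar_tail_uminus 3 bar_tail_merge_first) simp
    finally show ?thesis by simp
  qed auto
qed auto

text \<open>After \<open>bar_tail_bar_tail\<close> only terms that involve the first face remain,
  and these cancel in pairs.\<close>

lemma bar_diff_bar_diff [simp]: "bar_diff (bar_diff f) zs = 0"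
proof (cases zs)
  case (Cons x xs)
  show ?thesis
  proof (cases xs)
    case (Cons y ys)
    have "bar_tail (bar_diff f) (x # y # ys)
      = - f ys - bar_tail f ((x + y) # ys) - (bar_tail f (y # ys) + bar_tail (\<lambda>w. bar_tail f (x # w)) (y # ys))"
      by (simp add: bar_tail_add)
    moreover have "bar_tail (bar_tail f) (x # y # ys) = 0" by (rule bar_tail_bar_tail)
    ultimately show ?thesis by (simp add: Cons \<open>zs = _\<close> algebra_simps)
  qed (simp add: Cons)
qed auto

lemma bar_diff_bar_tail:
  "bar_diff (\<lambda>w. bar_tail (\<lambda>h. f h w) hs) ks = bar_tail (\<lambda>h. bar_diff (f h) ks) hs"
proof (induction hs arbitrary: f rule: induct_list012)
  case (2 x)
  show ?case by (simp add: bar_diff_additive[OF additive_uminus])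
next
  case (3 x y zs)
  have "bar_diff (\<lambda>w. bar_tail (\<lambda>h. f h w) (x # y # zs)) ks
    = bar_diff (\<lambda>w. - f ((x + y) # zs) w + - bar_tail (\<lambda>h. f (x # h) w) (y # zs)) ks"
    by simp
  also have "\<dots> = - bar_diff (f ((x + y) # zs)) ks - bar_diff (\<lambda>w. bar_tail (\<lambda>h. f (x # h) w) (y # zs)) ks"
    by (simp only: bar_diff_add bar_diff_additive[OF additive_uminus]) simp
  finally show ?case using 3(2)[of "\<lambda>h. f (x # h)"] by simp
qed auto

lemma merge_Cons_Suc: "1 \<le> j \<Longrightarrow> merge (Suc j) (x # zs) = x # merge j zs"
  by (cases j) (auto simp: merge_def)

text \<open>Passes from the recursion, which suits induction, to the indexed sums over
  \<open>merge\<close> used in \<open>d_hor\<close> and \<open>d_ver\<close>.\<close>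

lemma bar_tail_eq_sum:
  assumes "length zs = Suc n"
  shows "bar_tail f zs = (\<Sum>j\<in>{1..n}. alt j (f (merge j zs))) + alt (Suc n) (f (butlast zs))"
  using assms
proof (induction f zs arbitrary: n rule: bar_tail.induct)
  case (3 f x y zs)
  obtain m where n: "n = Suc m" using 3(2) by auto
  have "(\<Sum>j\<in>{1..n}. alt j (f (merge j (x # y # zs))))
    = - f ((x + y) # zs) + (\<Sum>j\<in>{1..m}. - alt j (f (x # merge j (y # zs))))"
  proof -
    have "(\<Sum>j\<in>{1..n}. alt j (f (merge j (x # y # zs))))
      = alt 1 (f (merge 1 (x # y # zs))) + (\<Sum>j\<in>{1..m}. alt (Suc j) (f (merge (Suc j) (x # y # zs))))"
      unfolding n by (subst sum.atLeast_Suc_atMost, simp, subst sum.shift_bounds_cl_Suc_ivl, rule refl)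
    moreover have "merge 1 (x # y # zs) = (x + y) # zs" by (simp add: merge_def)
    ultimately show ?thesis by (simp add: merge_Cons_Suc)
  qed
  moreover have "bar_tail (\<lambda>w. f (x # w)) (y # zs)
     = (\<Sum>j\<in>{1..m}. alt j (f (x # merge j (y # zs)))) + alt (Suc m) (f (x # butlast (y # zs)))"
    using 3 n by simp
  ultimately show ?case using n by (simp add: sum_negf)
qed auto

lemma bar_diff_eq_sum:
  assumes "length zs = Suc n"
  shows "bar_diff f zs = f (tl zs) + (\<Sum>j\<in>{1..n}. alt j (f (merge j zs))) + alt (Suc n) (f (butlast zs))"
  using assms bar_tail_eq_sum[OF assms, of f] by (cases zs) auto

text \<open>The linear extension of f evaluated on the signed shuffle product of xs and ys, sorted
  by first letter. The sign is that of moving y past all letters of \<open>x # xs\<close>.\<close>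

fun shuffle_eval :: "('h list \<Rightarrow> 'i::ab_group_add) \<Rightarrow> 'h list \<Rightarrow> 'h list \<Rightarrow> 'i" where
  "shuffle_eval f [] ys = f ys"
| "shuffle_eval f (x # xs) [] = f (x # xs)"
| "shuffle_eval f (x # xs) (y # ys) = shuffle_eval (\<lambda>w. f (x # w)) xs (y # ys)
     + alt (Suc (length xs)) (shuffle_eval (\<lambda>w. f (y # w)) (x # xs) ys)"

lemma shuffle_eval_Nil2 [simp]: "shuffle_eval f xs [] = f xs"
  by (cases xs) auto

lemma shuffle_eval_add:
  "shuffle_eval (\<lambda>w. f w + g w) xs ys = shuffle_eval f xs ys + shuffle_eval g xs ys"
  by (induction f xs ys arbitrary: g rule: shuffle_eval.induct) (auto simp: alt_add)

lemma shuffle_eval_additive: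
  assumes "additive p"
  shows "shuffle_eval (\<lambda>w. p (f w)) xs ys = p (shuffle_eval f xs ys)"
  by (induction f xs ys rule: shuffle_eval.induct)
     (auto simp: additive.minus[OF assms] additive.alt[OF assms] additive.add[OF assms] additive.diff[OF assms])

lemma shuffle_eval_uminus: "shuffle_eval (\<lambda>w. - f w) xs ys = - shuffle_eval f xs ys"
  by (rule shuffle_eval_additive[OF additive_uminus])

lemma shuffle_eval_diff:
  "shuffle_eval (\<lambda>w. f w - g w) xs ys = shuffle_eval f xs ys - shuffle_eval g xs ys"
  using shuffle_eval_add[of f "\<lambda>w. - g w"] by (simp add: shuffle_eval_uminus)

lemma shuffle_eval_map:
  "shuffle_eval f (map q xs) (map q ys) = shuffle_eval (\<lambda>w. f (map q w)) xs ys"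
  by (induction "\<lambda>w. f (map q w)" xs ys arbitrary: f rule: shuffle_eval.induct) auto

lemma shuffle_eval_cong:
  assumes "\<And>w. length w = length xs + length ys \<Longrightarrow> set w = set xs \<union> set ys \<Longrightarrow> f w = g w"
  shows "shuffle_eval f xs ys = shuffle_eval g xs ys"
  using assms
proof (induction f xs ys arbitrary: g rule: shuffle_eval.induct)
  case (3 f x xs y ys)
  have "shuffle_eval (\<lambda>w. f (x # w)) xs (y # ys) = shuffle_eval (\<lambda>w. g (x # w)) xs (y # ys)"
    by (rule 3(1)) (auto intro!: 3(3))
  moreover have "shuffle_eval (\<lambda>w. f (y # w)) (x # xs) ys = shuffle_eval (\<lambda>w. g (y # w)) (x # xs) ys"
    by (rule 3(2)) (auto intro!: 3(3))
  ultimately show ?case by simp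
qed auto

text \<open>The first two terms are the faces of \<open>x # y # zs\<close> that touch x. The third
  compensates the first face of \<open>bar_diff (\<lambda>w. f (x # w))\<close>, so that
  \<open>bar_diff_Cons\<close> recurses into \<open>bar_diff\<close> rather than
  \<open>bar_tail\<close>.\<close>

fun bar_first :: "'h::ab_group_add \<Rightarrow> ('h list \<Rightarrow> 'i::ab_group_add) \<Rightarrow> 'h list \<Rightarrow> 'i" where
  "bar_first x f [] = 0"
| "bar_first x f (y # zs) = f (y # zs) - f ((x + y) # zs) + f (x # zs)"

lemma bar_diff_Cons: "bar_diff f (x # zs) = bar_first x f zs - bar_diff (\<lambda>w. f (x # w)) zs"
  by (cases zs) auto

text \<open>The last term on the right comes from the words in which y directly follows x. It is
  symmetric in x and y and will cancel the corresponding term of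
  \<open>shuffle_eval_bar_first_right\<close>.\<close>

lemma shuffle_eval_bar_first_left:
  "shuffle_eval (bar_first x f) xs (y # ys)
    + alt (length xs) (bar_first x (\<lambda>w. shuffle_eval (\<lambda>v. f (y # v)) w ys) xs)
   = bar_first x (\<lambda>w. shuffle_eval f w (y # ys)) xs
    + alt (length xs) (shuffle_eval (\<lambda>v. f (y # v) - f ((x + y) # v) + f (x # v)) xs ys)"
  by (cases xs) (auto simp: shuffle_eval_add shuffle_eval_diff alt_add alt_diff algebra_simps)

lemma shuffle_eval_bar_first_right:
  "shuffle_eval (bar_first y f) (x # xs) ys + bar_first y (\<lambda>w. shuffle_eval (\<lambda>v. f (x # v)) xs w) ys
   = bar_first y (\<lambda>w. shuffle_eval f (x # xs) w) ys
    + shuffle_eval (\<lambda>v. f (x # v) - f ((y + x) # v) + f (y # v)) xs ys"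
  by (cases ys) (auto simp: shuffle_eval_add shuffle_eval_diff alt_add alt_diff algebra_simps)

text \<open>The graded Leibniz rule. After \<open>bar_diff_Cons\<close> the faces behind the first
  letter are matched by induction. The corrections from the two \<open>bar_first\<close> lemmas
  enter with opposite signs.\<close>

lemma shuffle_eval_bar_diff:
  "shuffle_eval (bar_diff f) xs ys
   = bar_diff (\<lambda>w. shuffle_eval f w ys) xs + alt (length xs) (bar_diff (\<lambda>w. shuffle_eval f xs w) ys)"
proof (induction f xs ys rule: shuffle_eval.induct)
  case (3 f x xs y ys)
  let ?p = "length xs"
  let ?fx = "\<lambda>w. f (x # w)" and ?fy = "\<lambda>w. f (y # w)"
  have eq: "shuffle_eval (bar_diff f) (x # xs) (y # ys)
     = shuffle_eval (bar_first x f) xs (y # ys) - shuffle_eval (bar_diff ?fx) xs (y # ys)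
     - alt ?p (shuffle_eval (bar_first y f) (x # xs) ys - shuffle_eval (bar_diff ?fy) (x # xs) ys)"
    by (simp only: shuffle_eval.simps bar_diff_Cons shuffle_eval_diff alt_Suc) simp
  have l: "bar_diff (\<lambda>w. shuffle_eval f w (y # ys)) (x # xs)
     = bar_first x (\<lambda>w. shuffle_eval f w (y # ys)) xs
       - bar_diff (\<lambda>w. shuffle_eval ?fx w (y # ys)) xs
       - alt ?p (bar_diff (\<lambda>w. shuffle_eval ?fy (x # w) ys) xs)"
  proof -
    have "bar_diff (\<lambda>w. shuffle_eval f (x # w) (y # ys)) xs
       = bar_diff (\<lambda>w. shuffle_eval ?fx w (y # ys) + alt ?p (shuffle_eval ?fy (x # w) ys)) xs"
      by (rule bar_diff_cong) simp
    then show ?thesis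
      by (simp only: bar_diff_Cons bar_diff_add bar_diff_additive[OF additive_alt]) simp
  qed
  have r: "bar_diff (\<lambda>w. shuffle_eval f (x # xs) w) (y # ys)
     = bar_first y (\<lambda>w. shuffle_eval f (x # xs) w) ys
       - bar_diff (\<lambda>w. shuffle_eval ?fx xs (y # w)) ys
       + alt ?p (bar_diff (\<lambda>w. shuffle_eval ?fy (x # xs) w) ys)"
    unfolding bar_diff_Cons shuffle_eval.simps bar_diff_add
      bar_diff_additive[OF additive_alt] by simp
  have sx: "bar_diff (\<lambda>w. shuffle_eval ?fx xs w) (y # ys)
     = bar_first y (\<lambda>w. shuffle_eval ?fx xs w) ys - bar_diff (\<lambda>w. shuffle_eval ?fx xs (y # w)) ys"
    by (rule bar_diff_Cons)
  have sy: "bar_diff (\<lambda>w. shuffle_eval ?fy w ys) (x # xs)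
     = bar_first x (\<lambda>w. shuffle_eval ?fy w ys) xs - bar_diff (\<lambda>w. shuffle_eval ?fy (x # w) ys) xs"
    by (rule bar_diff_Cons)
  have L: "shuffle_eval (bar_first x f) xs (y # ys)
     = bar_first x (\<lambda>w. shuffle_eval f w (y # ys)) xs
      + alt ?p (shuffle_eval (\<lambda>v. f (y # v) - f ((x + y) # v) + f (x # v)) xs ys)
      - alt ?p (bar_first x (\<lambda>w. shuffle_eval ?fy w ys) xs)"
    using shuffle_eval_bar_first_left[of x f xs y ys] by (simp add: algebra_simps)
  have R: "shuffle_eval (bar_first y f) (x # xs) ys
     = bar_first y (\<lambda>w. shuffle_eval f (x # xs) w) ys
      + shuffle_eval (\<lambda>v. f (x # v) - f ((y + x) # v) + f (y # v)) xs ys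
      - bar_first y (\<lambda>w. shuffle_eval ?fx xs w) ys"
    using shuffle_eval_bar_first_right[of y f x xs ys] by (simp add: algebra_simps)
  \<comment> \<open>Commutativity of H enters here: the corrections for y behind x and for x behind
    y agree.\<close>
  have sw: "(\<lambda>v. f (x # v) - f ((y + x) # v) + f (y # v)) = (\<lambda>v. f (y # v) - f ((x + y) # v) + f (x # v))"
    by (simp add: add.commute[of y x]) (simp add: algebra_simps)
  show ?case
    unfolding eq l r 3 sx sy L R sw
    by (simp add: alt_add alt_diff alt_minus alt_alt)
qed auto

section \<open>Recursion for shuffle permutations\<close>

definition permute_tuple :: "(nat \<Rightarrow> nat) \<Rightarrow> 'h list \<Rightarrow> 'h list"
  where "permute_tuple \<sigma> hs = map (\<lambda>i. hs ! (inv_into UNIV \<sigma> i - 1)) [1..<length hs + 1]"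

definition sign_times :: "(nat \<Rightarrow> nat) \<Rightarrow> 'i::ab_group_add \<Rightarrow> 'i"
  where "sign_times \<sigma> y = (if sign \<sigma> = 1 then y else - y)"

text \<open>The value on \<open>shuffle_sum l hs\<close> of the linear extension of g, see
  \<open>frag_lift_shuffle_sum\<close>.\<close>

definition shuffle_val :: "('h list \<Rightarrow> 'i::ab_group_add) \<Rightarrow> nat \<Rightarrow> 'h list \<Rightarrow> 'i"
  where "shuffle_val g l hs =
    (\<Sum>\<sigma>\<in>shuffle_perms l (length hs). sign_times \<sigma> (g (permute_tuple \<sigma> hs)))"

lemma permutation_of_permutes_atLeastAtMost: "\<sigma> permutes {a..b::nat} \<Longrightarrow> permutation \<sigma>"
  using permutes_imp_permutation by blast

lemma sign_times_compose:
  assumes "permutation \<sigma>" "permutation \<tau>"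
  shows "sign_times (\<sigma> \<circ> \<tau>) y = sign_times \<sigma> (sign_times \<tau> y)"
  unfolding sign_times_def sign_compose[OF assms]
  by (cases \<sigma> rule: sign_cases; cases \<tau> rule: sign_cases) auto

lemma sign_times_alt: "sign_times \<sigma> (alt n y) = alt n (sign_times \<sigma> y)"
  by (simp add: sign_times_def alt_minus)

lemma finite_shuffle_perms: "finite (shuffle_perms l s)"
  by (rule finite_subset[OF _ finite_permutations[of "{1..s}"]]) (auto simp: shuffle_perms_def)

lemma strict_mono_permutes_id:
  assumes p: "\<sigma> permutes {1..s::nat}" and m: "strict_mono_on {1..s} \<sigma>"
  shows "\<sigma> = id"
proof -
  have "1 \<le> i \<Longrightarrow> i \<le> s \<Longrightarrow> i \<le> \<sigma> i" for i
  proof (induction i rule: nat_induct_at_least[of 1])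
    case base
    then show ?case using permutes_in_image[OF p, of 1] by auto
  next
    case (Suc n)
    then have "\<sigma> n < \<sigma> (Suc n)" using strict_mono_onD[OF m, of n "Suc n"] by auto
    then show ?case using Suc by auto
  qed
  then show ?thesis using permutes_natset_ge[OF p] by auto
qed

lemma shuffle_perms_0: "shuffle_perms 0 s = {id}"
  unfolding shuffle_perms_def
  by (auto intro: strict_mono_permutes_id permutes_id strict_mono_onI)

lemma shuffle_perms_self: "shuffle_perms s s = {id}"
  unfolding shuffle_perms_def
  by (auto intro: strict_mono_permutes_id permutes_id strict_mono_onI)

section \<open>The cycle moving position l to the end, its sign, and the recursion for
  shuffles\<close>

definition to_last :: "nat \<Rightarrow> nat \<Rightarrow> nat \<Rightarrow> nat"
  where "to_last l n i = (if i = l \<and> l \<le> n then n else if l < i \<and> i \<le> n then i - 1 else i)"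

definition from_last :: "nat \<Rightarrow> nat \<Rightarrow> nat \<Rightarrow> nat"
  where "from_last l n i = (if i = n \<and> l \<le> n then l else if l \<le> i \<and> i < n then i + 1 else i)"

lemma to_last_from_last [simp]: "to_last l n (from_last l n i) = i"
  and from_last_to_last [simp]: "from_last l n (to_last l n i) = i"
  by (auto simp: to_last_def from_last_def)

lemma bij_to_last: "bij (to_last l n)"
  by (rule o_bij[of "from_last l n"]) (auto simp: fun_eq_iff)

lemma inv_to_last: "inv_into UNIV (to_last l n) = from_last l n"
  by (rule inv_equality) auto

lemma to_last_permutes: "1 \<le> l \<Longrightarrow> to_last l n permutes {1..n}"
  by (rule bij_imp_permutes, rule bij_betw_byWitness[where f' = "from_last l n"])
    (auto simp: to_last_def from_last_def)

lemma from_last_permutes: "1 \<le> l \<Longrightarrow> from_last l n permutes {1..n}"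
  using permutes_inv[OF to_last_permutes] by (simp add: inv_to_last)

text \<open>Each step adds one adjacent transposition, which gives the sign
  \<open>(-1)^(n - l)\<close> by induction.\<close>

lemma to_last_Suc: "l \<le> n \<Longrightarrow> to_last l (Suc n) = transpose n (Suc n) \<circ> to_last l n"
  by (auto simp: to_last_def fun_eq_iff transpose_def)

lemma to_last_self: "to_last l l = id"
  by (auto simp: to_last_def)

lemma sign_times_to_last:
  assumes "1 \<le> l" "l \<le> n" shows "sign_times (to_last l n) y = alt (n - l) y"
  using assms(2)
proof (induction n rule: dec_induct)
  case base
  then show ?case by (simp add: to_last_self sign_times_def)
next
  case (step n)
  have "sign_times (to_last l (Suc n)) y
    = sign_times (transpose n (Suc n)) (sign_times (to_last l n) y)"
    unfolding to_last_Suc[OF step(1)]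
    by (rule sign_times_compose)
      (auto intro: permutation_swap_id permutation_of_permutes_atLeastAtMost to_last_permutes[OF assms(1)])
  also have "\<dots> = - alt (n - l) y"
    unfolding step(3) by (simp add: sign_times_def sign_swap_id)
  finally show ?case using step by (simp add: Suc_diff_le)
qed

text \<open>
  A shuffle of \<open>{1..n+1}\<close> puts either position \<open>n + 1\<close> or position \<open>l\<close> last; removing that letter
  leaves a shuffle of \<open>{1..n}\<close>, in the second case after composing with a cycle of sign \<open>(-1)\<^bsup>n+1-l\<^esup>\<close>.
\<close>

lemma shuffle_perms_last_fixed:
  assumes "l \<le> n"
  shows "{\<sigma> \<in> shuffle_perms l (Suc n). \<sigma> (Suc n) = Suc n} = shuffle_perms l n"
proof (intro equalityI subsetI)
  fix \<sigma> assume "\<sigma> \<in> {\<sigma> \<in> shuffle_perms l (Suc n). \<sigma> (Suc n) = Suc n}"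
  then have p: "\<sigma> permutes {1..Suc n}" and m: "strict_mono_on {1..l} \<sigma>" "strict_mono_on {l+1..Suc n} \<sigma>"
    and e: "\<sigma> (Suc n) = Suc n"
    by (auto simp: shuffle_perms_def)
  have "\<sigma> permutes {1..n}"
    by (rule permutes_superset[OF p]) (use e in \<open>auto simp: le_Suc_eq\<close>)
  then show "\<sigma> \<in> shuffle_perms l n"
    using m by (auto simp: shuffle_perms_def intro: monotone_on_subset)
next
  fix \<sigma> assume "\<sigma> \<in> shuffle_perms l n"
  then have p: "\<sigma> permutes {1..n}" and m: "strict_mono_on {1..l} \<sigma>" "strict_mono_on {l+1..n} \<sigma>"
    by (auto simp: shuffle_perms_def)
  have e: "\<sigma> (Suc n) = Suc n" using permutes_not_in[OF p] by auto
  have "strict_mono_on {l+1..Suc n} \<sigma>"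
  proof (rule strict_mono_onI)
    fix i j assume ij: "i \<in> {l+1..Suc n}" "j \<in> {l+1..Suc n}" "i < j"
    show "\<sigma> i < \<sigma> j"
    proof (cases "j = Suc n")
      case True
      then have "\<sigma> i \<in> {1..n}" using ij permutes_in_image[OF p, of i] by auto
      then show ?thesis using True e by auto
    next
      case False
      then show ?thesis using ij strict_mono_onD[OF m(2), of i j] by auto
    qed
  qed
  moreover have "\<sigma> permutes {1..Suc n}" by (rule permutes_subset[OF p]) auto
  ultimately show "\<sigma> \<in> {\<sigma> \<in> shuffle_perms l (Suc n). \<sigma> (Suc n) = Suc n}"
    using m e by (auto simp: shuffle_perms_def)
qed

text \<open>Composing with the inverse cycle fixes the last position. Position l leaves the first
  block and the second block shifts down by one, so the blocks \<open>{1..l}\<close> and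
  \<open>{l+1..n+1}\<close> become \<open>{1..l-1}\<close> and \<open>{l..n}\<close>.\<close>

lemma shuffle_perms_last_moved:
  assumes l: "1 \<le> l" "l \<le> n"
  shows "{\<sigma> \<in> shuffle_perms l (Suc n). \<sigma> l = Suc n}
    = (\<lambda>\<tau>. \<tau> \<circ> to_last l (Suc n)) ` shuffle_perms (l - 1) n"
proof (intro equalityI subsetI)
  fix \<sigma> assume "\<sigma> \<in> {\<sigma> \<in> shuffle_perms l (Suc n). \<sigma> l = Suc n}"
  then have p: "\<sigma> permutes {1..Suc n}" and m: "strict_mono_on {1..l} \<sigma>" "strict_mono_on {l+1..Suc n} \<sigma>"
    and e: "\<sigma> l = Suc n"
    by (auto simp: shuffle_perms_def)
  let ?\<tau> = "\<sigma> \<circ> from_last l (Suc n)"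
  have "?\<tau> permutes {1..Suc n}" by (rule permutes_compose[OF from_last_permutes p]) (use l in auto)
  then have "?\<tau> permutes {1..n}"
    by (rule permutes_superset) (use e l in \<open>auto simp: le_Suc_eq from_last_def\<close>)
  moreover have "strict_mono_on {1..l-1} ?\<tau>"
  proof (rule strict_mono_onI)
    fix i j assume "i \<in> {1..l-1}" "j \<in> {1..l-1}" "i < j"
    then show "?\<tau> i < ?\<tau> j"
      using l strict_mono_onD[OF m(1), of i j] by (auto simp: from_last_def)
  qed
  moreover have "strict_mono_on {l-1+1..n} ?\<tau>"
  proof (rule strict_mono_onI)
    fix i j assume "i \<in> {l-1+1..n}" "j \<in> {l-1+1..n}" "i < j"
    then show "?\<tau> i < ?\<tau> j"
      using l strict_mono_onD[OF m(2), of "Suc i" "Suc j"] by (auto simp: from_last_def)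
  qed
  ultimately have "?\<tau> \<in> shuffle_perms (l-1) n" by (auto simp: shuffle_perms_def)
  moreover have "\<sigma> = ?\<tau> \<circ> to_last l (Suc n)" by (auto simp: fun_eq_iff)
  ultimately show "\<sigma> \<in> (\<lambda>\<tau>. \<tau> \<circ> to_last l (Suc n)) ` shuffle_perms (l - 1) n" by blast
next
  fix \<sigma> assume "\<sigma> \<in> (\<lambda>\<tau>. \<tau> \<circ> to_last l (Suc n)) ` shuffle_perms (l - 1) n"
  then obtain \<tau> where \<sigma>: "\<sigma> = \<tau> \<circ> to_last l (Suc n)" and p: "\<tau> permutes {1..n}"
    and m: "strict_mono_on {1..l-1} \<tau>" "strict_mono_on {l..n} \<tau>"
    using l by (auto simp: shuffle_perms_def)
  have e: "\<tau> (Suc n) = Suc n" using permutes_not_in[OF p] by auto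
  have "\<tau> permutes {1..Suc n}" by (rule permutes_subset[OF p]) auto
  then have "\<sigma> permutes {1..Suc n}"
    unfolding \<sigma> using l by (intro permutes_compose[OF to_last_permutes]) auto
  moreover have "strict_mono_on {1..l} \<sigma>"
  proof (rule strict_mono_onI)
    fix i j assume ij: "i \<in> {1..l}" "j \<in> {1..l}" "i < j"
    show "\<sigma> i < \<sigma> j"
    proof (cases "j = l")
      case True
      then have "\<tau> i \<in> {1..n}" using ij l permutes_in_image[OF p, of i] by auto
      then show ?thesis using True e ij l by (auto simp: \<sigma> to_last_def)
    next
      case False
      then show ?thesis using ij l strict_mono_onD[OF m(1), of i j] by (auto simp: \<sigma> to_last_def)
    qed
  qed
  moreover have "strict_mono_on {l+1..Suc n} \<sigma>"
  proof (rule strict_mono_onI)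
    fix i j assume "i \<in> {l+1..Suc n}" "j \<in> {l+1..Suc n}" "i < j"
    then show "\<sigma> i < \<sigma> j"
      using l strict_mono_onD[OF m(2), of "i - 1" "j - 1"] by (auto simp: \<sigma> to_last_def)
  qed
  ultimately show "\<sigma> \<in> {\<sigma> \<in> shuffle_perms l (Suc n). \<sigma> l = Suc n}"
    using e l by (auto simp: shuffle_perms_def \<sigma> to_last_def)
qed

text \<open>The largest value is taken at the end of one of the two increasing blocks.\<close>

lemma shuffle_perms_last_cases:
  assumes "\<sigma> \<in> shuffle_perms l (Suc n)" "1 \<le> l" "l \<le> n"
  shows "\<sigma> (Suc n) = Suc n \<or> \<sigma> l = Suc n"
proof -
  have p: "\<sigma> permutes {1..Suc n}" and m: "strict_mono_on {1..l} \<sigma>" "strict_mono_on {l+1..Suc n} \<sigma>"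
    using assms by (auto simp: shuffle_perms_def)
  obtain j where j: "j \<in> {1..Suc n}" "\<sigma> j = Suc n"
    using permutes_image[OF p] by (metis atLeastAtMost_iff imageE le_refl le_add1 plus_1_eq_Suc)
  have "\<sigma> i \<le> Suc n" if "i \<in> {1..Suc n}" for i using permutes_in_image[OF p, of i] that by auto
  then have "\<not> j < l" "\<not> (l < j \<and> j < Suc n)"
    using strict_mono_onD[OF m(1), of j l] strict_mono_onD[OF m(2), of j "Suc n"] j assms(2,3)
    by (auto simp: not_less[symmetric])
  then have "j = l \<or> j = Suc n" using j(1) by auto
  then show ?thesis using j by auto
qed

lemma permute_tuple_last_fixed:
  assumes "length hs = Suc n" "\<sigma> permutes {1..n}"
  shows "permute_tuple \<sigma> hs = permute_tuple \<sigma> (butlast hs) @ [last hs]"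
proof -
  have i: "inv_into UNIV \<sigma> permutes {1..n}" by (rule permutes_inv[OF assms(2)])
  have "inv_into UNIV \<sigma> (Suc n) = Suc n" using permutes_not_in[OF i] by auto
  moreover have "inv_into UNIV \<sigma> j \<in> {1..n}" if "j \<in> {1..n}" for j
    using permutes_in_image[OF i, of j] that by auto
  then have "hs ! (inv_into UNIV \<sigma> j - 1) = butlast hs ! (inv_into UNIV \<sigma> j - 1)" if "j \<in> {1..n}" for j
    using that assms by (subst nth_butlast) force+
  moreover have "last hs = hs ! n" using assms by (cases hs rule: rev_cases) (auto simp: nth_append)
  ultimately show ?thesis
    using assms by (auto simp: permute_tuple_def)
qed

lemma permute_tuple_last_moved:
  assumes "length hs = Suc n" "1 \<le> l" "l \<le> n" "\<tau> permutes {1..n}"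
  shows "permute_tuple (\<tau> \<circ> to_last l (Suc n)) hs
    = permute_tuple \<tau> (take (l - 1) hs @ drop l hs) @ [hs ! (l - 1)]"
proof -
  have i: "inv_into UNIV \<tau> permutes {1..n}" by (rule permutes_inv[OF assms(4)])
  have inv: "inv_into UNIV (\<tau> \<circ> to_last l (Suc n)) = from_last l (Suc n) \<circ> inv_into UNIV \<tau>"
    using o_inv_distrib[OF permutes_bij[OF assms(4)] bij_to_last] by (simp add: inv_to_last)
  have "inv_into UNIV \<tau> (Suc n) = Suc n" using permutes_not_in[OF i] by auto
  moreover have "hs ! (from_last l (Suc n) (inv_into UNIV \<tau> j) - 1)
      = (take (l - 1) hs @ drop l hs) ! (inv_into UNIV \<tau> j - 1)" if "j \<in> {1..n}" for j
  proof -
    have "inv_into UNIV \<tau> j \<in> {1..n}" using permutes_in_image[OF i, of j] that by auto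
    then show ?thesis using assms by (auto simp: from_last_def nth_append)
  qed
  ultimately show ?thesis
    using assms by (auto simp: permute_tuple_def inv from_last_def)
qed

text \<open>The sum splits by the letter placed last, which ends either the second block or the
  first. This is the recursion of \<open>shuffle_eval\<close> read from the right.\<close>

lemma shuffle_val_last:
  assumes hs: "length hs = Suc n" and l: "1 \<le> l" "l \<le> n"
  shows "shuffle_val g l hs = shuffle_val (\<lambda>w. g (w @ [last hs])) l (butlast hs)
    + alt (Suc n - l) (shuffle_val (\<lambda>w. g (w @ [hs ! (l - 1)])) (l - 1) (take (l - 1) hs @ drop l hs))"
proof -
  let ?c = "to_last l (Suc n)"
  let ?t = "\<lambda>\<sigma>. sign_times \<sigma> (g (permute_tuple \<sigma> hs))"
  have ne: "\<sigma> l \<noteq> \<sigma> (Suc n)" if "\<sigma> \<in> shuffle_perms l (Suc n)" for \<sigma>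
    using that l permutes_inj[of \<sigma> "{1..Suc n}"] injD[of \<sigma> l "Suc n"] by (auto simp: shuffle_perms_def)
  have disj: "shuffle_perms l n \<inter> (\<lambda>\<tau>. \<tau> \<circ> ?c) ` shuffle_perms (l - 1) n = {}"
    unfolding shuffle_perms_last_moved[OF l, symmetric] shuffle_perms_last_fixed[OF l(2), symmetric]
  proof (rule equals0I, elim IntE CollectE conjE)
    fix \<sigma> assume "\<sigma> \<in> shuffle_perms l (Suc n)" "\<sigma> (Suc n) = Suc n" "\<sigma> l = Suc n"
    then show False using ne[of \<sigma>] by simp
  qed
  have un: "shuffle_perms l (Suc n) = shuffle_perms l n \<union> (\<lambda>\<tau>. \<tau> \<circ> ?c) ` shuffle_perms (l - 1) n"
    unfolding shuffle_perms_last_moved[OF l, symmetric] shuffle_perms_last_fixed[OF l(2), symmetric]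
  proof (intro equalityI subsetI)
    fix \<sigma> assume "\<sigma> \<in> shuffle_perms l (Suc n)"
    then show "\<sigma> \<in> {\<sigma> \<in> shuffle_perms l (Suc n). \<sigma> (Suc n) = Suc n}
        \<union> {\<sigma> \<in> shuffle_perms l (Suc n). \<sigma> l = Suc n}"
      using shuffle_perms_last_cases[of \<sigma> l n] l by simp
  qed auto
  have inj: "inj_on (\<lambda>\<tau>. \<tau> \<circ> ?c) (shuffle_perms (l - 1) n)"
  proof (intro inj_onI ext)
    fix \<tau> \<tau>' i assume "\<tau> \<circ> ?c = \<tau>' \<circ> ?c"
    then have "(\<tau> \<circ> ?c) (from_last l (Suc n) i) = (\<tau>' \<circ> ?c) (from_last l (Suc n) i)" by (rule fun_cong)
    then show "\<tau> i = \<tau>' i" by simp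
  qed
  have "shuffle_val g l hs = sum ?t (shuffle_perms l n)
      + (\<Sum>\<tau>\<in>shuffle_perms (l - 1) n. ?t (\<tau> \<circ> ?c))"
    unfolding shuffle_val_def hs un
      sum.union_disjoint[OF finite_shuffle_perms finite_imageI[OF finite_shuffle_perms] disj]
      sum.reindex[OF inj] comp_def[of ?t] by (rule refl)
  moreover have "sum ?t (shuffle_perms l n) = shuffle_val (\<lambda>w. g (w @ [last hs])) l (butlast hs)"
  proof -
    have "length (butlast hs) = n" using hs by simp
    then show ?thesis unfolding shuffle_val_def
      by (intro sum.cong) (simp_all add: permute_tuple_last_fixed[OF hs] shuffle_perms_def)
  qed
  moreover have "(\<Sum>\<tau>\<in>shuffle_perms (l - 1) n. ?t (\<tau> \<circ> ?c))
     = alt (Suc n - l) (shuffle_val (\<lambda>w. g (w @ [hs ! (l - 1)])) (l - 1) (take (l - 1) hs @ drop l hs))"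
  proof -
    have len: "length (take (l - 1) hs @ drop l hs) = n" using hs l by auto
    have "?t (\<tau> \<circ> ?c) = alt (Suc n - l)
        (sign_times \<tau> (g (permute_tuple \<tau> (take (l - 1) hs @ drop l hs) @ [hs ! (l - 1)])))"
      if \<tau>: "\<tau> \<in> shuffle_perms (l - 1) n" for \<tau>
    proof -
      have p: "\<tau> permutes {1..n}" using \<tau> by (auto simp: shuffle_perms_def)
      have "?t (\<tau> \<circ> ?c) = sign_times \<tau> (sign_times ?c (g (permute_tuple (\<tau> \<circ> ?c) hs)))"
        by (rule sign_times_compose)
          (use l p to_last_permutes[of l "Suc n"] in \<open>auto intro!: permutation_of_permutes_atLeastAtMost[of _ 1]\<close>)
      also have "\<dots> = sign_times \<tau> (alt (Suc n - l)
          (g (permute_tuple \<tau> (take (l - 1) hs @ drop l hs) @ [hs ! (l - 1)])))"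
        using l by (simp only: sign_times_to_last le_SucI permute_tuple_last_moved[OF hs l p])
      finally show ?thesis by (simp only: sign_times_alt)
    qed
    then show ?thesis unfolding shuffle_val_def len alt_sum by (rule sum.cong[OF refl])
  qed
  ultimately show ?thesis by simp
qed

lemma permute_tuple_id [simp]: "permute_tuple id hs = hs"
  by (rule nth_equalityI) (simp_all add: permute_tuple_def del: upt_Suc)

text \<open>
  Tuples are reversed because \<open>shuffle_eval\<close> recurses on first letters, whereas the recursion for
  permutations splits off the last one, which avoids shifting the positions.
\<close>

lemma shuffle_val_eq_shuffle_eval:
  assumes "l \<le> length hs"
  shows "shuffle_val g l hs = shuffle_eval (\<lambda>w. g (rev w)) (rev (drop l hs)) (rev (take l hs))"
  using assms
proof (induction "length hs" arbitrary: g l hs)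
  case 0
  then show ?case by (simp add: shuffle_val_def shuffle_perms_0 sign_times_def)
next
  case (Suc n)
  consider "l = 0" | "l = Suc n" | "1 \<le> l" "l \<le> n" using Suc by linarith
  then show ?case
  proof cases
    case 1
    then show ?thesis by (simp add: shuffle_val_def shuffle_perms_0 sign_times_def)
  next
    case 2
    then have "l = length hs" using Suc(2) by simp
    then show ?thesis unfolding shuffle_val_def by (simp add: shuffle_perms_self sign_times_def)
  next
    case 3
    let ?hs' = "take (l - 1) hs @ drop l hs"
    have d: "rev (drop l hs) = last hs # rev (drop l (butlast hs))"
      using Suc(2) 3 by (cases hs rule: rev_cases) auto
    have t: "rev (take l hs) = hs ! (l - 1) # rev (take (l - 1) hs)"
      using Suc(2) 3 take_Suc_conv_app_nth[of "l - 1" hs] by auto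
    have b: "take l (butlast hs) = take l hs"
      using Suc(2) 3 by (simp add: take_butlast)
    have t': "take (l - 1) ?hs' = take (l - 1) hs" "drop (l - 1) ?hs' = drop l hs"
      using Suc(2) 3 by auto
    have 1: "shuffle_val (\<lambda>w. g (w @ [last hs])) l (butlast hs)
       = shuffle_eval (\<lambda>w. g (rev w @ [last hs])) (rev (drop l (butlast hs))) (rev (take l (butlast hs)))"
      using Suc(2) 3 by (intro Suc(1)) auto
    have 2: "shuffle_val (\<lambda>w. g (w @ [hs ! (l - 1)])) (l - 1) ?hs'
       = shuffle_eval (\<lambda>w. g (rev w @ [hs ! (l - 1)])) (rev (drop (l - 1) ?hs')) (rev (take (l - 1) ?hs'))"
      using Suc(2) 3 by (intro Suc(1)) auto
    \<comment> \<open>The sign in \<open>shuffle_eval\<close> counts the letters of its first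
      argument, hence the second block stands first there: letter l passes its n + 1 - l
      letters.\<close>
    have len: "Suc (length (rev (drop l (butlast hs)))) = Suc n - l"
      using Suc(2) 3 by auto
    show ?thesis
      unfolding shuffle_val_last[OF Suc(2)[symmetric] 3] 1 2 b t' d t shuffle_eval.simps len
      by simp
  qed
qed

section \<open>Homomorphisms out of quotients and tensor products\<close>

lemma additive_group_simps [simp]:
  "carrier additive_group = UNIV" "x \<otimes>\<^bsub>additive_group\<^esub> y = x + y" "\<one>\<^bsub>additive_group\<^esub> = 0"
  by (simp_all add: additive_group_def)

lemma comm_group_additive_group: "comm_group (additive_group :: 'a::ab_group_add monoid)"
proof (rule comm_groupI)
  fix x :: 'a
  show "\<exists>y\<in>carrier additive_group. y \<otimes>\<^bsub>additive_group\<^esub> x = \<one>\<^bsub>additive_group\<^esub>"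
    by (rule bexI[of _ "- x"]) auto
qed (auto simp: algebra_simps)

lemma group_additive_group [simp]: "group additive_group"
  by (rule comm_group.axioms(2)[OF comm_group_additive_group])

lemma hom_additive_groupI:
  "(\<And>x y. x \<in> carrier G \<Longrightarrow> y \<in> carrier G \<Longrightarrow> f (x \<otimes>\<^bsub>G\<^esub> y) = f x + f y) \<Longrightarrow> f \<in> hom G additive_group"
  by (auto simp: hom_def)

lemma hom_additive_groupD:
  "f \<in> hom G additive_group \<Longrightarrow> x \<in> carrier G \<Longrightarrow> y \<in> carrier G \<Longrightarrow> f (x \<otimes>\<^bsub>G\<^esub> y) = f x + f y"
  by (auto simp: hom_def)

lemma hom_additive_group_one:
  assumes "group G" "f \<in> hom G additive_group"
  shows "f \<one>\<^bsub>G\<^esub> = 0"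
  using hom_one[OF assms(2,1)] by simp

text \<open>Chosen on all formal combinations over the type, so that one map restricts to the free
  group on every set of generators.\<close>

definition frag_lift :: "('k \<Rightarrow> 'i::ab_group_add) \<Rightarrow> ('k \<Rightarrow>\<^sub>0 int) \<Rightarrow> 'i"
  where "frag_lift g = (SOME h. additive h \<and> (\<forall>k. h (frag_of k) = g k))"

lemma frag_lift: "additive (frag_lift g)" "frag_lift g (frag_of k) = g k"
proof -
  obtain h where "h \<in> hom (free_Abelian_group UNIV) additive_group" "\<And>x. h (frag_of x) = g x"
    using comm_group.free_Abelian_group_universal[OF comm_group_additive_group, of g UNIV] by auto
  then have "additive h \<and> (\<forall>k. h (frag_of k) = g k)"
    by (auto simp: additive_def dest: hom_additive_groupD)
  then have "additive (frag_lift g) \<and> (\<forall>k. frag_lift g (frag_of k) = g k)"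
    unfolding frag_lift_def by (rule someI[where P = "\<lambda>h. additive h \<and> (\<forall>k. h (frag_of k) = g k)"])
  then show "additive (frag_lift g)" "frag_lift g (frag_of k) = g k" by auto
qed

lemma frag_lift_hom: "frag_lift g \<in> hom (free_Abelian_group S) additive_group"
  by (rule hom_additive_groupI) (simp add: additive.add[OF frag_lift(1)])

lemma hom_free_Abelian_group_eqI:
  assumes f: "f \<in> hom (free_Abelian_group S) additive_group" and g: "g \<in> hom (free_Abelian_group S) additive_group"
    and eq: "\<And>x. x \<in> S \<Longrightarrow> f (frag_of x) = g (frag_of x)"
    and c: "Poly_Mapping.keys c \<subseteq> S"
  shows "f c = g c"
proof (rule free_Abelian_group_induct[OF c])
  show "f 0 = g 0"
    using hom_additive_group_one[OF group_free_Abelian_group f]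
      hom_additive_group_one[OF group_free_Abelian_group g] by simp
next
  fix x y
  assume *: "Poly_Mapping.keys x \<subseteq> S" "Poly_Mapping.keys y \<subseteq> S" "f x = g x" "f y = g y"
  have "Poly_Mapping.keys (x - y) \<subseteq> S" using * keys_diff[of x y] by blast
  then have "h x = h (x - y) + h y" if "h \<in> hom (free_Abelian_group S) additive_group" for h :: "_ \<Rightarrow> 'b"
    using hom_additive_groupD[OF that, of "x - y" y] * by simp
  from this[OF f] this[OF g] * show "f (x - y) = g (x - y)" by simp
qed (rule eq)

lemma frag_lift_unique:
  assumes "f \<in> hom (free_Abelian_group S) additive_group" "\<And>x. x \<in> S \<Longrightarrow> f (frag_of x) = g x"
    "Poly_Mapping.keys c \<subseteq> S"
  shows "f c = frag_lift g c"
  by (rule hom_free_Abelian_group_eqI[OF assms(1) frag_lift_hom _ assms(3)]) (simp add: frag_lift assms(2))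

lemma frag_lift_cong:
  assumes "\<And>x. x \<in> S \<Longrightarrow> g x = h x" "Poly_Mapping.keys c \<subseteq> S"
  shows "frag_lift g c = frag_lift h c"
  by (rule frag_lift_unique[OF frag_lift_hom _ assms(2)]) (simp add: frag_lift assms(1))

text \<open>Uniqueness of the linear extension. It makes the pairing in
  \<open>cochain_exists\<close> additive in its second argument.\<close>

lemma frag_lift_sum_functions: "frag_lift (\<lambda>x. g x + h x) c = frag_lift g c + frag_lift h c"
proof (rule frag_lift_unique[symmetric, of _ UNIV])
  show "(\<lambda>c. frag_lift g c + frag_lift h c) \<in> hom (free_Abelian_group UNIV) additive_group"
    by (rule hom_additive_groupI) (simp add: additive.add[OF frag_lift(1)])
qed (auto simp: frag_lift)

section \<open>Quotient groups\<close>

lemma generate_normal: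
  assumes "comm_group G" "X \<subseteq> carrier G"
  shows "generate G X \<lhd> G"
  using assms by (simp add: comm_group.normal_iff_subgroup group.generate_is_subgroup comm_group.axioms(2))

lemma quotient_class_hom:
  assumes "N \<lhd> G" shows "quotient_class G N \<in> hom G (G Mod N)"
  using normal.r_coset_hom_Mod[OF assms] by (simp add: quotient_class_def[abs_def])

lemma quotient_class_carrier:
  "N \<lhd> G \<Longrightarrow> x \<in> carrier G \<Longrightarrow> quotient_class G N x \<in> carrier (G Mod N)"
  using quotient_class_hom[of N G] by (auto simp: hom_def)

lemma quotient_class_surj:
  assumes "m \<in> carrier (G Mod N)" obtains x where "x \<in> carrier G" "m = quotient_class G N x"
  using assms by (auto simp: carrier_FactGroup quotient_class_def)

lemma quotient_class_one:
  assumes "N \<lhd> G" "x \<in> N" shows "quotient_class G N x = \<one>\<^bsub>G Mod N\<^esub>"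
  using assms group.coset_join2[of G x N] normal_imp_subgroup[OF assms(1)] subgroup.mem_carrier
  by (fastforce simp: quotient_class_def FactGroup_def normal_def)

lemma quotient_universal:
  assumes G: "comm_group G" and X: "X \<subseteq> carrier G"
    and k: "k \<in> hom G additive_group" and k0: "\<And>x. x \<in> X \<Longrightarrow> k x = 0"
  obtains g where "g \<in> hom (G Mod generate G X) additive_group"
    "\<And>x. x \<in> carrier G \<Longrightarrow> g (quotient_class G (generate G X) x) = k x"
proof -
  interpret gh: group_hom G additive_group k
    using G k
    by (simp add: group_hom_def group_hom_axioms_def comm_group.axioms(2))
  have "X \<subseteq> kernel G additive_group k" using X k0 by (auto simp: kernel_def)
  then have "generate G X \<subseteq> kernel G additive_group k"
    by (rule gh.G.generate_subgroup_incl[OF _ gh.subgroup_kernel])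
  then show ?thesis
    using gh.FactGroup_universal_kernel[OF generate_normal[OF G X]] that
    unfolding quotient_class_def by metis
qed

section \<open>Tensor products\<close>

lemma tensor_relations_carrier:
  assumes "group A" "group B"
  shows "tensor_relations A B \<subseteq> carrier (free_Abelian_group (carrier A \<times> carrier B))"
proof -
  have "Poly_Mapping.keys (frag_of x - frag_of y - frag_of z) \<subseteq> {x, y, z}" for x y z :: "'a \<times> 'b"
    using keys_diff[of "frag_of x - frag_of y" "frag_of z"] keys_diff[of "frag_of x" "frag_of y"]
    by (auto simp: keys_frag_of)
  then have "frag_of x - frag_of y - frag_of z \<in> carrier (free_Abelian_group S)"
    if "x \<in> S" "y \<in> S" "z \<in> S" for x y z :: "'a \<times> 'b" and S
    using that by (meson carrier_free_Abelian_group_iff empty_subsetI insert_subset order_trans)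
  note in_carrier = this
  show ?thesis
  proof
    fix x assume "x \<in> tensor_relations A B"
    then consider a a' b where "x = frag_of (a \<otimes>\<^bsub>A\<^esub> a', b) - frag_of (a, b) - frag_of (a', b)"
        "a \<in> carrier A" "a' \<in> carrier A" "b \<in> carrier B"
      | a b b' where "x = frag_of (a, b \<otimes>\<^bsub>B\<^esub> b') - frag_of (a, b) - frag_of (a, b')"
        "a \<in> carrier A" "b \<in> carrier B" "b' \<in> carrier B"
      unfolding tensor_relations_def by blast
    then show "x \<in> carrier (free_Abelian_group (carrier A \<times> carrier B))"
      by cases (metis (no_types, lifting) assms SigmaI group.is_monoid in_carrier monoid.m_closed)+
  qed
qed

context
  fixes A :: "('a, 'm) monoid_scheme" and B :: "('b, 'n) monoid_scheme"
  assumes A: "comm_group A" and B: "comm_group B"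
begin

interpretation A: comm_group A by (rule A)
interpretation B: comm_group B by (rule B)

abbreviation (input) "FAB \<equiv> free_Abelian_group (carrier A \<times> carrier B)"

lemma tensor_normal: "tensor_subgroup A B \<lhd> FAB"
  unfolding tensor_subgroup_def
  by (rule generate_normal[OF abelian_free_Abelian_group tensor_relations_carrier[OF A.is_group B.is_group]])

lemma comm_group_tensor_product: "comm_group (tensor_product A B)"
  unfolding tensor_product_def
  by (rule comm_group.abelian_FactGroup[OF abelian_free_Abelian_group normal_imp_subgroup[OF tensor_normal]])

lemma tensor_class_hom:
  "quotient_class FAB (tensor_subgroup A B) \<in> hom FAB (tensor_product A B)"
  unfolding tensor_product_def by (rule quotient_class_hom[OF tensor_normal])

lemma pure_tensor_carrier:
  "a \<in> carrier A \<Longrightarrow> b \<in> carrier B \<Longrightarrow> pure_tensor A B a b \<in> carrier (tensor_product A B)"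
  unfolding pure_tensor_def tensor_product_def
  by (rule quotient_class_carrier[OF tensor_normal]) simp

text \<open>Both families of tensor relations have the shape x - y - z on generators, so one
  argument yields linearity in either factor.\<close>

lemma hom_tensor_relation:
  assumes f: "f \<in> hom (tensor_product A B) additive_group"
    and rel: "frag_of x - frag_of y - frag_of z \<in> tensor_relations A B"
    and c: "x \<in> carrier A \<times> carrier B" "y \<in> carrier A \<times> carrier B" "z \<in> carrier A \<times> carrier B"
  shows "f (quotient_class FAB (tensor_subgroup A B) (frag_of x))
    = f (quotient_class FAB (tensor_subgroup A B) (frag_of y)) + f (quotient_class FAB (tensor_subgroup A B) (frag_of z))"
proof -
  define q where "q = f \<circ> quotient_class FAB (tensor_subgroup A B)"
  let ?r = "frag_of x - frag_of y - frag_of z"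
  have q: "q \<in> hom FAB additive_group" unfolding q_def by (rule hom_compose[OF tensor_class_hom f])
  have "?r \<in> tensor_subgroup A B" unfolding tensor_subgroup_def using rel by (rule generate.incl)
  then have "q ?r = f \<one>\<^bsub>tensor_product A B\<^esub>"
    unfolding q_def tensor_product_def by (simp add: quotient_class_one[OF tensor_normal])
  then have r0: "q ?r = 0"
    using hom_additive_group_one[OF comm_group.axioms(2)[OF comm_group_tensor_product] f] by simp
  have rc: "?r \<in> carrier FAB"
    using tensor_relations_carrier[OF A.is_group B.is_group] rel by blast
  have yz: "frag_of y \<in> carrier FAB" "frag_of z \<in> carrier FAB" using c by simp_all
  have yzc: "frag_of y \<otimes>\<^bsub>FAB\<^esub> frag_of z \<in> carrier FAB"
    by (rule monoid.m_closed[OF group.is_monoid[OF group_free_Abelian_group] yz])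
  \<comment> \<open>In the free group the relation plus y + z is x, and q kills the
    relation.\<close>
  have "q (?r \<otimes>\<^bsub>FAB\<^esub> (frag_of y \<otimes>\<^bsub>FAB\<^esub> frag_of z)) = q ?r + (q (frag_of y) + q (frag_of z))"
    unfolding hom_additive_groupD[OF q rc yzc] hom_additive_groupD[OF q yz] by (rule refl)
  then have "q (frag_of x) = q (frag_of y) + q (frag_of z)" using r0 by simp
  then show ?thesis unfolding q_def by simp
qed

lemma hom_pure_tensor_left:
  assumes f: "f \<in> hom (tensor_product A B) additive_group" and b: "b \<in> carrier B"
  shows "(\<lambda>a. f (pure_tensor A B a b)) \<in> hom A additive_group"
proof (rule hom_additive_groupI)
  fix a a' assume "a \<in> carrier A" "a' \<in> carrier A"
  with b show "f (pure_tensor A B (a \<otimes>\<^bsub>A\<^esub> a') b) = f (pure_tensor A B a b) + f (pure_tensor A B a' b)"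
    unfolding pure_tensor_def by (intro hom_tensor_relation[OF f]) (auto simp: tensor_relations_def)
qed

lemma hom_pure_tensor_right:
  assumes f: "f \<in> hom (tensor_product A B) additive_group" and a: "a \<in> carrier A"
  shows "(\<lambda>b. f (pure_tensor A B a b)) \<in> hom B additive_group"
proof (rule hom_additive_groupI)
  fix b b' assume "b \<in> carrier B" "b' \<in> carrier B"
  with a show "f (pure_tensor A B a (b \<otimes>\<^bsub>B\<^esub> b')) = f (pure_tensor A B a b) + f (pure_tensor A B a b')"
    unfolding pure_tensor_def by (intro hom_tensor_relation[OF f]) (auto simp: tensor_relations_def)
qed

lemma hom_tensor_product_eqI:
  assumes f: "f \<in> hom (tensor_product A B) additive_group" and g: "g \<in> hom (tensor_product A B) additive_group"
    and eq: "\<And>a b. a \<in> carrier A \<Longrightarrow> b \<in> carrier B \<Longrightarrow> f (pure_tensor A B a b) = g (pure_tensor A B a b)"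
    and t: "t \<in> carrier (tensor_product A B)"
  shows "f t = g t"
proof -
  obtain c where c: "c \<in> carrier FAB" "t = quotient_class FAB (tensor_subgroup A B) c"
    using t unfolding tensor_product_def by (rule quotient_class_surj)
  have "(f \<circ> quotient_class FAB (tensor_subgroup A B)) c = (g \<circ> quotient_class FAB (tensor_subgroup A B)) c"
    by (rule hom_free_Abelian_group_eqI[OF hom_compose[OF tensor_class_hom f] hom_compose[OF tensor_class_hom g]])
      (use c eq in \<open>auto simp: pure_tensor_def\<close>)
  then show ?thesis using c by simp
qed

lemma tensor_product_universal:
  fixes p :: "'a \<Rightarrow> 'b \<Rightarrow> 'i::ab_group_add"
  assumes l: "\<And>b. b \<in> carrier B \<Longrightarrow> (\<lambda>a. p a b) \<in> hom A additive_group"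
    and r: "\<And>a. a \<in> carrier A \<Longrightarrow> p a \<in> hom B additive_group"
  obtains f where "f \<in> hom (tensor_product A B) additive_group"
    "\<And>a b. a \<in> carrier A \<Longrightarrow> b \<in> carrier B \<Longrightarrow> f (pure_tensor A B a b) = p a b"
proof -
  let ?k = "frag_lift (case_prod p)"
  have "?k x = 0" if "x \<in> tensor_relations A B" for x
    using that unfolding tensor_relations_def
    by (auto simp: additive.diff[OF frag_lift(1)] frag_lift(2)
        hom_additive_groupD[OF l] hom_additive_groupD[OF r])
  then obtain f where "f \<in> hom (tensor_product A B) additive_group"
    "\<And>x. x \<in> carrier FAB \<Longrightarrow> f (quotient_class FAB (tensor_subgroup A B) x) = ?k x"
    using quotient_universal[OF abelian_free_Abelian_group tensor_relations_carrier[OF A.is_group B.is_group]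
        frag_lift_hom]
    unfolding tensor_product_def tensor_subgroup_def by metis
  then show ?thesis using that[of f] by (simp add: pure_tensor_def frag_lift(2))
qed

end

lemma comm_group_Hom_group:
  assumes G: "monoid G" and K: "comm_group K"
  shows "comm_group (Hom_group G K)"
proof -
  interpret G: monoid G by (rule G)
  interpret K: comm_group K by (rule K)
  have closed: "f x \<in> carrier K" if "f \<in> hom G K" "x \<in> carrier G" for f x
    using that by (auto simp: hom_def)
  show ?thesis
  proof (rule comm_groupI)
    fix f assume "f \<in> carrier (Hom_group G K)"
    then show "\<exists>g\<in>carrier (Hom_group G K). g \<otimes>\<^bsub>Hom_group G K\<^esub> f = \<one>\<^bsub>Hom_group G K\<^esub>"
      by (intro bexI[of _ "\<lambda>x\<in>carrier G. inv\<^bsub>K\<^esub> f x"])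
        (auto simp: Hom_group_def hom_def K.inv_mult fun_eq_iff Pi_iff)
  qed (auto simp: Hom_group_def hom_def extensional_def fun_eq_iff K.m_ac Pi_iff)
qed

section \<open>Cochains as functions on tuples\<close>

lemma nz_tuplesD: "hs \<in> nz_tuples r \<Longrightarrow> length hs = r" "hs \<in> nz_tuples r \<Longrightarrow> 0 \<notin> set hs"
  by (auto simp: nz_tuples_def)

lemma comm_group_free_tuples: "comm_group (free_tuples r)"
  unfolding free_tuples_def by (rule abelian_free_Abelian_group)

lemma permute_tuple_nz:
  assumes "\<sigma> permutes {1..length ks}" "ks \<in> nz_tuples s"
  shows "permute_tuple \<sigma> ks \<in> nz_tuples s"
proof -
  have "inv_into UNIV \<sigma> i - 1 < length ks" if "i \<in> {1..length ks}" for i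
    using permutes_in_image[OF permutes_inv[OF assms(1)], of i] that by auto
  then have "set (permute_tuple \<sigma> ks) \<subseteq> set ks"
    by (auto simp: permute_tuple_def simp del: upt_Suc intro!: nth_mem)
  then show ?thesis using assms(2) by (auto simp: nz_tuples_def permute_tuple_def)
qed

lemma frag_cmul_sign: "frag_cmul (sign \<sigma>) c = sign_times \<sigma> c"
  by (cases \<sigma> rule: sign_cases) (simp_all add: sign_times_def)

lemma shuffle_sum_eq:
  "shuffle_sum l ks = (\<Sum>\<sigma>\<in>shuffle_perms l (length ks). sign_times \<sigma> (frag_of (permute_tuple \<sigma> ks)))"
  unfolding shuffle_sum_def permute_tuple_def[symmetric] frag_cmul_sign by (rule refl)

lemma shuffle_sum_carrier:
  assumes "ks \<in> nz_tuples s"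
  shows "shuffle_sum l ks \<in> carrier (free_tuples s)"
  unfolding shuffle_sum_eq free_tuples_def
proof (rule sum_closed_free_Abelian_group)
  fix \<sigma> assume "\<sigma> \<in> shuffle_perms l (length ks)"
  then have "permute_tuple \<sigma> ks \<in> nz_tuples s"
    using permute_tuple_nz[OF _ assms] by (auto simp: shuffle_perms_def)
  then show "sign_times \<sigma> (frag_of (permute_tuple \<sigma> ks)) \<in> carrier (free_Abelian_group (nz_tuples s))"
    by (auto simp: sign_times_def)
qed

lemma frag_lift_shuffle_sum: "frag_lift g (shuffle_sum l ks) = shuffle_val g l ks"
  unfolding shuffle_sum_eq shuffle_val_def additive.sum[OF frag_lift(1)]
  by (intro sum.cong refl) (auto simp: sign_times_def additive.minus[OF frag_lift(1)] frag_lift(2))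

lemma shuffle_generators_carrier:
  "{shuffle_sum l hs |l hs. 1 \<le> l \<and> l < s \<and> hs \<in> nz_tuples s} \<subseteq> carrier (free_tuples s)"
  using shuffle_sum_carrier by blast

lemma shuffle_normal: "shuffle_subgroup s \<lhd> free_tuples s"
  unfolding shuffle_subgroup_def
  by (rule generate_normal[OF comm_group_free_tuples shuffle_generators_carrier])

lemma comm_group_M_group: "comm_group (M_group s)"
  unfolding M_group_def
  by (rule comm_group.abelian_FactGroup[OF comm_group_free_tuples normal_imp_subgroup[OF shuffle_normal]])

lemma frag_of_free_tuples: "hs \<in> nz_tuples r \<Longrightarrow> frag_of hs \<in> carrier (free_tuples r)"
  by (simp add: free_tuples_def)

lemma M_class_carrier: "ks \<in> nz_tuples s \<Longrightarrow> M_class ks \<in> carrier (M_group s)"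
  unfolding M_class_def M_group_def
  using quotient_class_carrier[OF shuffle_normal frag_of_free_tuples] nz_tuplesD(1) by blast

lemma monoid_cochain_source: "monoid (tensor_product (free_tuples r) (M_group s))"
  by (rule group.is_monoid[OF comm_group.axioms(2)[OF
        comm_group_tensor_product[OF comm_group_free_tuples comm_group_M_group]]])

lemma comm_group_C_bigr: "comm_group (C_bigr r s)"
  unfolding C_bigr_def by (rule comm_group_Hom_group[OF monoid_cochain_source comm_group_additive_group])

lemma group_C_bigr [simp]: "group (C_bigr r s)"
  by (rule comm_group.axioms(2)[OF comm_group_C_bigr])

lemma C_bigr_carrierD: "f \<in> carrier (C_bigr r s) \<Longrightarrow>
    f \<in> hom (tensor_product (free_tuples r) (M_group s)) additive_group"
  by (simp add: C_bigr_def Hom_group_def)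

lemma value_at_nz: "hs \<in> nz_tuples r \<Longrightarrow> ks \<in> nz_tuples s \<Longrightarrow>
    value_at f hs ks = f (pure_tensor (free_tuples r) (M_group s) (frag_of hs) (M_class ks))"
  by (auto simp: value_at_def nz_tuples_def)

lemma value_at_0: "0 \<in> set hs \<or> 0 \<in> set ks \<Longrightarrow> value_at f hs ks = 0"
  by (auto simp: value_at_def)

lemma pure_tensor_source_carrier:
  "hs \<in> nz_tuples r \<Longrightarrow> ks \<in> nz_tuples s \<Longrightarrow>
    pure_tensor (free_tuples r) (M_group s) (frag_of hs) (M_class ks)
      \<in> carrier (tensor_product (free_tuples r) (M_group s))"
  by (rule pure_tensor_carrier[OF comm_group_free_tuples comm_group_M_group
        frag_of_free_tuples M_class_carrier])

lemma value_at_mult: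
  assumes "length hs = r" "length ks = s"
  shows "value_at (f \<otimes>\<^bsub>C_bigr r s\<^esub> g) hs ks = value_at f hs ks + value_at g hs ks"
proof (cases "0 \<in> set hs \<or> 0 \<in> set ks")
  case False
  with assms have nz: "hs \<in> nz_tuples r" "ks \<in> nz_tuples s" by (auto simp: nz_tuples_def)
  then show ?thesis
    by (simp add: value_at_nz[OF nz] C_bigr_def Hom_group_def pure_tensor_source_carrier)
qed (simp add: value_at_0)

lemma value_at_one:
  assumes "length hs = r" "length ks = s"
  shows "value_at \<one>\<^bsub>C_bigr r s\<^esub> hs ks = 0"
proof (cases "0 \<in> set hs \<or> 0 \<in> set ks")
  case False
  with assms have nz: "hs \<in> nz_tuples r" "ks \<in> nz_tuples s" by (auto simp: nz_tuples_def)
  then show ?thesis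
    by (simp add: value_at_nz[OF nz] C_bigr_def Hom_group_def pure_tensor_source_carrier)
qed (simp add: value_at_0)

lemma value_at_finprod:
  assumes "finite A" "\<And>k. k \<in> A \<Longrightarrow> F k \<in> carrier (C_bigr r s)" "length hs = r" "length ks = s"
  shows "value_at (finprod (C_bigr r s) F A) hs ks = (\<Sum>k\<in>A. value_at (F k) hs ks)"
  using assms(1,2)
proof (induction A)
  interpret comm_group "C_bigr r s" by (rule comm_group_C_bigr)
  case empty
  then show ?case by (simp add: value_at_one[OF assms(3,4)])
next
  interpret comm_group "C_bigr r s" by (rule comm_group_C_bigr)
  case (insert x A)
  then show ?case by (simp add: finprod_insert value_at_mult[OF assms(3,4)] Pi_iff)
qed

text \<open>For fixed hs both sides are additive in c and agree on tuples; values on arbitrary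
  classes thus reduce to \<open>value_at\<close>.\<close>

lemma class_value_eq_frag_lift:
  assumes f: "f \<in> carrier (C_bigr r s)" and hs: "hs \<in> nz_tuples r" and c: "c \<in> carrier (free_tuples s)"
  shows "f (pure_tensor (free_tuples r) (M_group s) (frag_of hs)
      (quotient_class (free_tuples s) (shuffle_subgroup s) c)) = frag_lift (value_at f hs) c"
proof -
  let ?p = "(\<lambda>b. f (pure_tensor (free_tuples r) (M_group s) (frag_of hs) b))
    \<circ> quotient_class (free_tuples s) (shuffle_subgroup s)"
  have h: "(\<lambda>b. f (pure_tensor (free_tuples r) (M_group s) (frag_of hs) b)) \<in> hom (M_group s) additive_group"
    by (rule hom_pure_tensor_right[OF comm_group_free_tuples comm_group_M_group C_bigr_carrierD[OF f]
          frag_of_free_tuples[OF hs]])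
  have "?p \<in> hom (free_tuples s) additive_group"
    by (rule hom_compose[OF _ h]) (unfold M_group_def, rule quotient_class_hom[OF shuffle_normal])
  then have "?p c = frag_lift (value_at f hs) c"
    unfolding free_tuples_def
    by (rule frag_lift_unique)
      (use c in \<open>auto simp: value_at_nz[OF hs] M_class_def free_tuples_def dest: nz_tuplesD(1)\<close>)
  then show ?thesis by simp
qed

lemma value_at_shuffle:
  assumes f: "f \<in> carrier (C_bigr r s)" and hs: "hs \<in> nz_tuples r" and ks: "ks \<in> nz_tuples s"
    and l: "1 \<le> l" "l < s"
  shows "shuffle_val (value_at f hs) l ks = 0"
proof -
  have "shuffle_sum l ks \<in> shuffle_subgroup s"
    unfolding shuffle_subgroup_def by (rule generate.incl) (use ks l in auto)
  then have "quotient_class (free_tuples s) (shuffle_subgroup s) (shuffle_sum l ks) = \<one>\<^bsub>M_group s\<^esub>"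
    unfolding M_group_def by (rule quotient_class_one[OF shuffle_normal])
  then have "shuffle_val (value_at f hs) l ks
      = f (pure_tensor (free_tuples r) (M_group s) (frag_of hs) \<one>\<^bsub>M_group s\<^esub>)"
    using class_value_eq_frag_lift[OF f hs shuffle_sum_carrier[OF ks, of l]]
    by (simp add: frag_lift_shuffle_sum)
  also have "\<dots> = 0"
    by (rule hom_additive_group_one[OF comm_group.axioms(2)[OF comm_group_M_group]
        hom_pure_tensor_right[OF comm_group_free_tuples comm_group_M_group C_bigr_carrierD[OF f]
          frag_of_free_tuples[OF hs]]])
  finally show ?thesis .
qed

text \<open>The uniqueness behind the definite description in \<open>cochain_with_values\<close>.
  Pure tensors suffice, and these are reduced to generators one factor at a time.\<close>

lemma C_bigr_eqI:
  fixes f g :: "'h::zero chain \<Rightarrow> 'i::ab_group_add"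
  assumes f: "f \<in> carrier (C_bigr r s)" and g: "g \<in> carrier (C_bigr r s)"
    and eq: "\<And>hs ks. hs \<in> nz_tuples r \<Longrightarrow> ks \<in> nz_tuples s \<Longrightarrow> value_at f hs ks = value_at g hs ks"
  shows "f = g"
proof (rule extensionalityI)
  let ?T = "tensor_product (free_tuples r :: ('h list \<Rightarrow>\<^sub>0 int) monoid) (M_group s :: ('h list \<Rightarrow>\<^sub>0 int) set monoid)"
  show "f \<in> extensional (carrier ?T)" "g \<in> extensional (carrier ?T)"
    using f g by (auto simp: C_bigr_def Hom_group_def)
  fix t assume "t \<in> carrier ?T"
  then show "f t = g t"
  proof (rule hom_tensor_product_eqI[OF comm_group_free_tuples comm_group_M_group
        C_bigr_carrierD[OF f] C_bigr_carrierD[OF g], rotated])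
    fix a :: "'h list \<Rightarrow>\<^sub>0 int" and b :: "('h list \<Rightarrow>\<^sub>0 int) set" assume a: "a \<in> carrier (free_tuples r)" and b: "b \<in> carrier (M_group s)"
    obtain c where c: "c \<in> carrier (free_tuples s)" "b = quotient_class (free_tuples s) (shuffle_subgroup s) c"
      using b unfolding M_group_def by (rule quotient_class_surj)
    have left: "(\<lambda>a. h (pure_tensor (free_tuples r) (M_group s) a b))
        \<in> hom (free_Abelian_group (nz_tuples r)) additive_group"
      if "h \<in> carrier (C_bigr r s)" for h :: "'h chain \<Rightarrow> 'i"
      using hom_pure_tensor_left[OF comm_group_free_tuples comm_group_M_group C_bigr_carrierD[OF that] b]
      by (simp add: free_tuples_def)
    show "f (pure_tensor (free_tuples r) (M_group s) a b) = g (pure_tensor (free_tuples r) (M_group s) a b)"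
    proof (rule hom_free_Abelian_group_eqI[OF left[OF f] left[OF g]])
      fix hs :: "'h list" assume hs: "hs \<in> nz_tuples r"
      show "f (pure_tensor (free_tuples r) (M_group s) (frag_of hs) b)
          = g (pure_tensor (free_tuples r) (M_group s) (frag_of hs) b)"
        unfolding c(2) class_value_eq_frag_lift[OF f hs c(1)] class_value_eq_frag_lift[OF g hs c(1)]
        by (rule frag_lift_cong[of "nz_tuples s"]) (use eq hs c in \<open>auto simp: free_tuples_def\<close>)
    qed (use a in \<open>simp add: free_tuples_def\<close>)
  qed
qed

text \<open>Two stages: for each hs the shuffle relations let \<open>F hs\<close> descend to a
  homomorphism \<open>q hs\<close> on M(s); these are extended linearly in hs, and the bilinear
  pairing factors through the tensor product.\<close>

lemma cochain_exists:
  fixes F :: "'h::zero list \<Rightarrow> 'h list \<Rightarrow> 'i::ab_group_add"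
  assumes sh: "\<And>hs ks l. hs \<in> nz_tuples r \<Longrightarrow> ks \<in> nz_tuples s \<Longrightarrow> 1 \<le> l \<Longrightarrow> l < s
    \<Longrightarrow> shuffle_val (F hs) l ks = 0"
  shows "\<exists>g \<in> carrier (C_bigr r s). \<forall>hs\<in>nz_tuples r. \<forall>ks\<in>nz_tuples s. value_at g hs ks = F hs ks"
proof -
  have "\<exists>q. q \<in> hom (M_group s) additive_group \<and>
      (\<forall>x \<in> carrier (free_tuples s). q (quotient_class (free_tuples s) (shuffle_subgroup s) x) = frag_lift (F hs) x)"
    if hs: "hs \<in> nz_tuples r" for hs
  proof -
    have h: "frag_lift (F hs) \<in> hom (free_tuples s) additive_group"
      unfolding free_tuples_def by (rule frag_lift_hom)
    have h0: "frag_lift (F hs) x = 0"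
      if "x \<in> {shuffle_sum l ks |l ks. 1 \<le> l \<and> l < s \<and> ks \<in> nz_tuples s}" for x
      using that sh[OF hs] by (auto simp: frag_lift_shuffle_sum)
    show ?thesis
      unfolding M_group_def shuffle_subgroup_def
      by (rule quotient_universal[OF comm_group_free_tuples shuffle_generators_carrier h h0])
        (assumption, intro exI conjI ballI, assumption, blast)
  qed
  then obtain q where q: "\<And>hs. hs \<in> nz_tuples r \<Longrightarrow> q hs \<in> hom (M_group s) additive_group"
    and qv: "\<And>hs x. hs \<in> nz_tuples r \<Longrightarrow> x \<in> carrier (free_tuples s) \<Longrightarrow>
      q hs (quotient_class (free_tuples s) (shuffle_subgroup s) x) = frag_lift (F hs) x"
    by metis
  define p where "p a b = frag_lift (\<lambda>hs. q hs b) a" for a b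
  have "p a (b \<otimes>\<^bsub>M_group s\<^esub> b') = p a b + p a b'"
    if "a \<in> carrier (free_tuples r)" "b \<in> carrier (M_group s)" "b' \<in> carrier (M_group s)" for a b b'
    unfolding p_def frag_lift_sum_functions[symmetric]
    by (rule frag_lift_cong[of "nz_tuples r"])
      (use that hom_additive_groupD[OF q] in \<open>auto simp: free_tuples_def\<close>)
  then have pr: "p a \<in> hom (M_group s) additive_group" if "a \<in> carrier (free_tuples r)" for a
    using that by (intro hom_additive_groupI)
  have pl: "(\<lambda>a. p a b) \<in> hom (free_tuples r) additive_group" for b
    unfolding p_def free_tuples_def by (rule frag_lift_hom)
  obtain f where f: "f \<in> hom (tensor_product (free_tuples r) (M_group s)) additive_group"
    and fv: "\<And>a b. a \<in> carrier (free_tuples r) \<Longrightarrow> b \<in> carrier (M_group s) \<Longrightarrow>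
      f (pure_tensor (free_tuples r) (M_group s) a b) = p a b"
    using tensor_product_universal[OF comm_group_free_tuples comm_group_M_group pl pr] by blast
  let ?T = "tensor_product (free_tuples r :: ('h list \<Rightarrow>\<^sub>0 int) monoid) (M_group s :: ('h list \<Rightarrow>\<^sub>0 int) set monoid)"
  \<comment> \<open>Elements of \<open>Hom_group\<close> are extensional, hence the
    restriction.\<close>
  let ?g = "restrict f (carrier ?T)"
  have "?g \<in> carrier (C_bigr r s)"
    using f by (auto simp: C_bigr_def Hom_group_def hom_def monoid.m_closed[OF monoid_cochain_source])
  moreover have "value_at ?g hs ks = F hs ks" if hs: "hs \<in> nz_tuples r" and ks: "ks \<in> nz_tuples s" for hs ks
  proof -
    have "value_at ?g hs ks = q hs (M_class ks)"
      by (simp add: value_at_nz[OF hs ks] pure_tensor_source_carrier[OF hs ks]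
          fv[OF frag_of_free_tuples[OF hs] M_class_carrier[OF ks]] p_def frag_lift(2))
    also have "\<dots> = F hs ks"
      using qv[OF hs frag_of_free_tuples[OF ks]] nz_tuplesD(1)[OF ks]
      by (simp add: M_class_def frag_lift(2))
    finally show ?thesis .
  qed
  ultimately show ?thesis by blast
qed

lemma cochain_with_values:
  assumes "\<And>hs ks l. hs \<in> nz_tuples r \<Longrightarrow> ks \<in> nz_tuples s \<Longrightarrow> 1 \<le> l \<Longrightarrow> l < s
    \<Longrightarrow> shuffle_val (F hs) l ks = 0"
  shows "cochain_with_values r s F \<in> carrier (C_bigr r s)"
    and "hs \<in> nz_tuples r \<Longrightarrow> ks \<in> nz_tuples s \<Longrightarrow> value_at (cochain_with_values r s F) hs ks = F hs ks"
proof -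
  let ?P = "\<lambda>g. g \<in> carrier (C_bigr r s) \<and> (\<forall>hs\<in>nz_tuples r. \<forall>ks\<in>nz_tuples s. value_at g hs ks = F hs ks)"
  obtain g where g: "?P g" using cochain_exists[of r s F] assms by blast
  have "?P (cochain_with_values r s F)"
    unfolding cochain_with_values_def
    by (rule theI[of ?P, OF g], rule C_bigr_eqI) (use g in auto)
  then show "cochain_with_values r s F \<in> carrier (C_bigr r s)"
    and "hs \<in> nz_tuples r \<Longrightarrow> ks \<in> nz_tuples s \<Longrightarrow> value_at (cochain_with_values r s F) hs ks = F hs ks"
    by auto
qed

text \<open>Words with zeros are included because merging letters can create zeros. The reversal
  matches \<open>shuffle_val_eq_shuffle_eval\<close>.\<close>

definition shuffle_vanishing :: "nat \<Rightarrow> nat \<Rightarrow> ('h::zero list \<Rightarrow> 'h list \<Rightarrow> 'i::ab_group_add) \<Rightarrow> bool"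
  where "shuffle_vanishing r s F \<longleftrightarrow> (\<forall>hs xs ys. length hs = r \<longrightarrow> xs \<noteq> [] \<longrightarrow> ys \<noteq> [] \<longrightarrow>
     length xs + length ys = s \<longrightarrow> shuffle_eval (\<lambda>w. F hs (rev w)) xs ys = 0)"

text \<open>The normalization condition, matching the convention for zero entries built into
  \<open>value_at\<close>.\<close>

definition degenerate_vanishing :: "nat \<Rightarrow> nat \<Rightarrow> ('h::zero list \<Rightarrow> 'h list \<Rightarrow> 'i::ab_group_add) \<Rightarrow> bool"
  where "degenerate_vanishing r s F \<longleftrightarrow> (\<forall>hs ks. length hs = r \<longrightarrow> length ks = s \<longrightarrow>
     0 \<in> set hs \<union> set ks \<longrightarrow> F hs ks = 0)"

lemma shuffle_vanishingD:
  "shuffle_vanishing r s F \<Longrightarrow> length hs = r \<Longrightarrow> xs \<noteq> [] \<Longrightarrow> ys \<noteq> [] \<Longrightarrow> length xs + length ys = s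
    \<Longrightarrow> shuffle_eval (\<lambda>w. F hs (rev w)) xs ys = 0"
  by (simp add: shuffle_vanishing_def)

lemma degenerate_vanishingD:
  "degenerate_vanishing r s F \<Longrightarrow> length hs = r \<Longrightarrow> length ks = s \<Longrightarrow> 0 \<in> set hs \<union> set ks \<Longrightarrow> F hs ks = 0"
  unfolding degenerate_vanishing_def by blast

lemma shuffle_eval_zero [simp]: "shuffle_eval (\<lambda>w. 0) xs ys = 0"
  using shuffle_eval_diff[of "\<lambda>w. 0" "\<lambda>w. 0" xs ys] by simp

lemma degenerate_vanishing_value_at: "degenerate_vanishing r s (value_at f)"
  by (auto simp: degenerate_vanishing_def value_at_def)

lemma shuffle_vanishing_value_at:
  assumes f: "f \<in> carrier (C_bigr r s)"
  shows "shuffle_vanishing r s (value_at f)"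
  unfolding shuffle_vanishing_def
proof (intro allI impI)
  fix hs xs ys :: "'a list"
  assume *: "length hs = r" "xs \<noteq> []" "ys \<noteq> []" "length xs + length ys = s"
  show "shuffle_eval (\<lambda>w. value_at f hs (rev w)) xs ys = 0"
  proof (cases "0 \<in> set hs \<or> 0 \<in> set xs \<union> set ys")
    case True
    \<comment> \<open>Every shuffle of xs and ys contains all their letters, so each term has a zero
      entry.\<close>
    then have "shuffle_eval (\<lambda>w. value_at f hs (rev w)) xs ys = shuffle_eval (\<lambda>w. 0) xs ys"
      by (intro shuffle_eval_cong) (auto simp: value_at_0)
    then show ?thesis by simp
  next
    case False
    \<comment> \<open>Cut after \<open>length ys\<close>, with both pieces reversed, this tuple
      gives back ys and xs.\<close>
    let ?ks = "rev ys @ rev xs"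
    have "shuffle_val (value_at f hs) (length ys) ?ks = 0"
      by (rule value_at_shuffle[OF f]) (use * False in \<open>auto simp: nz_tuples_def Suc_le_eq\<close>)
    then show ?thesis by (simp add: shuffle_val_eq_shuffle_eval)
  qed
qed

text \<open>The prescribed values hold on tuples with zeros too, so faces can be evaluated without
  checking their entries.\<close>

lemma cochain_with_values_full:
  assumes sh: "shuffle_vanishing r s F" and deg: "degenerate_vanishing r s F"
  shows "cochain_with_values r s F \<in> carrier (C_bigr r s)"
    and "length hs = r \<Longrightarrow> length ks = s \<Longrightarrow> value_at (cochain_with_values r s F) hs ks = F hs ks"
proof -
  have *: "shuffle_val (F hs) l ks = 0" if "hs \<in> nz_tuples r" "ks \<in> nz_tuples s" "1 \<le> l" "l < s" for hs ks l
  proof -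
    have "shuffle_eval (\<lambda>w. F hs (rev w)) (rev (drop l ks)) (rev (take l ks)) = 0"
      by (rule shuffle_vanishingD[OF sh])
        (use that nz_tuplesD(1)[OF that(1)] nz_tuplesD(1)[OF that(2)] in auto)
    then show ?thesis using that by (simp add: shuffle_val_eq_shuffle_eval nz_tuples_def)
  qed
  show "cochain_with_values r s F \<in> carrier (C_bigr r s)" by (rule cochain_with_values(1)) (rule *)
  show "value_at (cochain_with_values r s F) hs ks = F hs ks" if "length hs = r" "length ks = s"
  proof (cases "0 \<in> set hs \<union> set ks")
    case True
    then show ?thesis using deg that by (auto simp: degenerate_vanishing_def value_at_0)
  next
    case False
    then show ?thesis using that by (intro cochain_with_values(2)) (auto simp: nz_tuples_def intro!: *[unfolded nz_tuples_def])
  qed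
qed

section \<open>The twisted complex\<close>

lemma alt_self: "alt n (alt n x) = x"
  by (simp add: alt_def)

text \<open>On words of length n + 1 reversal exchanges face j with face n + 1 - j, the two
  deletions included; the merged letters agree because H is commutative.\<close>

lemma bar_diff_rev:
  "bar_diff f (rev zs) = alt (length zs) (bar_diff (\<lambda>w. f (rev w)) zs)"
proof (cases zs)
  case Nil
  then show ?thesis by simp
next
  case (Cons z zs')
  define n where "n = length zs'"
  have len: "length zs = Suc n" using Cons by (simp add: n_def)
  have merge: "merge (Suc n - j) (rev zs) = rev (merge j zs)" if jn: "j \<in> {1..n}" for j
  proof -
    obtain i where j: "j = Suc i" using jn by (cases j) auto
    have "i < n" using jn j by auto
    then have "take (n - Suc i) (rev zs) = rev (drop (Suc (Suc i)) zs)"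
        "drop (Suc (n - i)) (rev zs) = rev (take i zs)"
        "rev zs ! (n - Suc i) = zs ! Suc i" "rev zs ! (n - i) = zs ! i"
      using len by (auto simp: take_rev drop_rev rev_nth Suc_diff_le)
    then show ?thesis by (simp add: merge_def j add.commute)
  qed
  have "(\<Sum>j\<in>{1..n}. alt j (f (merge j (rev zs))))
    = (\<Sum>j\<in>{1..n}. alt (Suc n - j) (f (merge (Suc n - j) (rev zs))))"
    by (rule sum.reindex_bij_witness[of _ "\<lambda>j. Suc n - j" "\<lambda>j. Suc n - j"]) auto
  also have "\<dots> = (\<Sum>j\<in>{1..n}. alt (Suc n) (alt j (f (rev (merge j zs)))))"
  proof (rule sum.cong[OF refl])
    fix j assume j: "j \<in> {1..n}"
    then have "even (Suc n - j) = even (Suc n + j)" by auto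
    then show "alt (Suc n - j) (f (merge (Suc n - j) (rev zs))) = alt (Suc n) (alt j (f (rev (merge j zs))))"
      unfolding merge[OF j] alt_alt by (simp only: alt_def)
  qed
  moreover have "tl (rev zs) = rev (butlast zs)" "butlast (rev zs) = rev (tl zs)"
    by (cases zs rule: rev_cases; simp) (simp add: butlast_rev)
  moreover have "bar_diff f (rev zs) = f (tl (rev zs)) + (\<Sum>j\<in>{1..n}. alt j (f (merge j (rev zs))))
      + alt (Suc n) (f (butlast (rev zs)))"
    by (rule bar_diff_eq_sum) (simp add: len)
  ultimately show ?thesis
    unfolding bar_diff_eq_sum[OF len] len by (simp only: alt_add alt_sum alt_self add_ac)
qed

text \<open>The Leibniz rule leaves a bar differential in each factor separately. The hypothesis
  covers only nonempty factors, so words of one letter need care.\<close>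

lemma shuffle_eval_bar_diff_vanishing:
  assumes v: "\<And>xs ys. xs \<noteq> [] \<Longrightarrow> ys \<noteq> [] \<Longrightarrow> length xs + length ys = n \<Longrightarrow> shuffle_eval f xs ys = 0"
    and ne: "xs \<noteq> []" "ys \<noteq> []" and len: "length xs + length ys = Suc n"
  shows "shuffle_eval (bar_diff f) xs ys = 0"
proof -
  have z: "bar_diff g zs = 0" if "zs \<noteq> []" "\<And>w. w \<noteq> [] \<Longrightarrow> Suc (length w) = length zs \<Longrightarrow> g w = 0"
    for g :: "'a list \<Rightarrow> 'b" and zs
  proof (cases "tl zs")
    case Nil
    \<comment> \<open>On one letter both faces are \<open>g []\<close> and cancel, whatever this
      value is.\<close>
    then show ?thesis using that by (cases zs) auto
  next
    case (Cons a as)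
    have "bar_diff g zs = bar_diff (\<lambda>w. 0) zs"
    proof (rule bar_diff_cong)
      fix w :: "'a list" assume w: "Suc (length w) = length zs"
      have "w \<noteq> []" using w Cons by (cases zs) auto
      then show "g w = 0" using w by (rule that(2))
    qed
    then show ?thesis by simp
  qed
  have "bar_diff (\<lambda>w. shuffle_eval f w ys) xs = 0" by (rule z) (use ne len v in auto)
  moreover have "bar_diff (\<lambda>w. shuffle_eval f xs w) ys = 0" by (rule z) (use ne len v in auto)
  ultimately show ?thesis by (simp add: shuffle_eval_bar_diff)
qed

lemma shuffle_eval_bar_tail:
  "shuffle_eval (\<lambda>w. bar_tail (\<lambda>h. f h w) hs) xs ys = bar_tail (\<lambda>h. shuffle_eval (f h) xs ys) hs"
proof (induction hs arbitrary: f rule: induct_list012)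
  case (2 x)
  show ?case by (simp add: shuffle_eval_uminus)
next
  case (3 x y zs)
  show ?case using 3(2)[of "\<lambda>h. f (x # h)"] by (simp add: shuffle_eval_diff shuffle_eval_uminus)
qed simp

text \<open>Merging 0 into the next letter, or deleting it if it is alone, gives the right side; all
  other faces keep a zero.\<close>

lemma bar_tail_zero_first:
  assumes "\<And>w. Suc (length w) = length (0 # zs) \<Longrightarrow> 0 \<in> set w \<Longrightarrow> f w = 0"
  shows "bar_tail f (0 # zs) = - f zs"
proof (cases zs)
  case (Cons y zs')
  have "bar_tail (\<lambda>w. f (0 # w)) (y # zs') = bar_tail (\<lambda>w. 0) (y # zs')"
    by (rule bar_tail_cong) (use assms Cons in auto)
  then show ?thesis using Cons by simp
qed simp

text \<open>The zero is absorbed by its left neighbour in one face, and by its right neighbour (or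
  by deletion at the end) in the next. These agree up to opposite signs; other faces keep a
  zero.\<close>

lemma bar_tail_zero_later:
  assumes "\<And>w. length w = length zs \<Longrightarrow> 0 \<in> set w \<Longrightarrow> f w = 0" "0 \<in> set zs"
  shows "bar_tail f (x # zs) = 0"
  using assms
proof (induction zs arbitrary: x f)
  case (Cons y zs)
  show ?case
  proof (cases "0 \<in> set zs")
    case True
    then have "bar_tail (\<lambda>w. f (x # w)) (y # zs) = 0" by (intro Cons.IH Cons.prems(1)) auto
    then show ?thesis using True Cons.prems(1)[of "(x + y) # zs"] by simp
  next
    case False
    then have y: "y = 0" using Cons.prems(2) by auto
    have "bar_tail (\<lambda>w. f (x # w)) (0 # zs) = - f (x # zs)"
      by (rule bar_tail_zero_first) (auto intro!: Cons.prems(1))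
    then show ?thesis by (simp add: y)
  qed
qed simp

text \<open>For a leading zero the first face cancels the term left by
  \<open>bar_tail_zero_first\<close>.\<close>

lemma bar_diff_degenerate:
  assumes "\<And>w. Suc (length w) = length zs \<Longrightarrow> 0 \<in> set w \<Longrightarrow> f w = 0" "0 \<in> set zs"
  shows "bar_diff f zs = 0"
proof (cases zs)
  case (Cons x zs')
  show ?thesis
  proof (cases "0 \<in> set zs'")
    case True
    then have "bar_tail f (x # zs') = 0" by (intro bar_tail_zero_later) (use assms Cons in auto)
    then show ?thesis using True Cons assms by auto
  next
    case False
    then have "x = 0" using Cons assms by auto
    moreover have "bar_tail f (0 # zs') = - f zs'" by (rule bar_tail_zero_first) (use assms Cons in auto)
    ultimately show ?thesis using Cons by simp
  qed
qed simp

text \<open>The operator T of the overview. The second piece is nonempty, matching s \<ge> 1, so a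
  word of length n has n cuts, one for each component of a total cochain of degree n.\<close>

fun sum_splits :: "('h list \<Rightarrow> 'h list \<Rightarrow> 'i::ab_group_add) \<Rightarrow> 'h list \<Rightarrow> 'i" where
  "sum_splits F [] = 0"
| "sum_splits F (x # xs) = F [] (x # xs) + sum_splits (\<lambda>h. F (x # h)) xs"

lemma sum_splits_eq_sum: "sum_splits F hs = (\<Sum>k\<in>{1..length hs}. F (take (length hs - k) hs) (drop (length hs - k) hs))"
proof -
  have "sum_splits F hs = (\<Sum>r<length hs. F (take r hs) (drop r hs))"
  proof (induction hs arbitrary: F)
    case (Cons x xs)
    then show ?case by (simp add: sum.lessThan_Suc_shift del: sum.lessThan_Suc)
  qed simp
  also have "\<dots> = (\<Sum>k\<in>{1..length hs}. F (take (length hs - k) hs) (drop (length hs - k) hs))"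
    by (rule sum.reindex_bij_witness[of _ "\<lambda>k. length hs - k" "\<lambda>k. length hs - k"]) auto
  finally show ?thesis .
qed

lemma sum_splits_cong:
  assumes "\<And>h k. k \<noteq> [] \<Longrightarrow> length h + length k = length hs \<Longrightarrow> F h k = G h k"
  shows "sum_splits F hs = sum_splits G hs"
  unfolding sum_splits_eq_sum by (rule sum.cong) (auto intro!: assms)

lemma sum_splits_add: "sum_splits (\<lambda>h k. F h k + G h k) hs = sum_splits F hs + sum_splits G hs"
  by (simp add: sum_splits_eq_sum sum.distrib)

lemma sum_splits_diff: "sum_splits (\<lambda>h k. F h k - G h k) hs = sum_splits F hs - sum_splits G hs"
  by (simp add: sum_splits_eq_sum sum_subtractf)

lemma sum_splits_additive:
  "additive p \<Longrightarrow> sum_splits (\<lambda>h k. p (F h k)) hs = p (sum_splits F hs)"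
  by (simp add: sum_splits_eq_sum additive.sum)

lemma sum_splits_map: "sum_splits (\<lambda>h k. F (map q h) (map q k)) hs = sum_splits F (map q hs)"
  by (simp add: sum_splits_eq_sum take_map drop_map)

text \<open>Used for T applied to D f: only the last cut has a second piece of one letter.\<close>

lemma sum_splits_last:
  "sum_splits (\<lambda>h k. case k of [z] \<Rightarrow> e h z | _ \<Rightarrow> 0) (hs @ [z]) = e hs z"
proof (induction hs arbitrary: e)
  case (Cons y hs)
  have "(case y # hs @ [z] of [z] \<Rightarrow> e [] z | _ \<Rightarrow> 0) = 0" by (cases hs) auto
  then show ?case using Cons[of "\<lambda>h. e (y # h)"] by simp
qed simp

text \<open>Deleting the last letter of h at one cut and the first letter of k at the previous cut
  leaves the same pair with opposite signs. If k is one letter, its two deletions cancel. The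
  remaining faces are the cuts of the faces of hs.\<close>

lemma sum_splits_bar:
  "sum_splits (\<lambda>h k. bar_tail (\<lambda>w. F w k) h + alt (length h) (bar_diff (F h) k)) hs
   = bar_tail (sum_splits F) hs"
proof (induction hs arbitrary: F)
  case (Cons x t)
  let ?W = "\<lambda>F h k. bar_tail (\<lambda>w. F w k) h + alt (length h) (bar_diff (F h) k)"
  \<comment> \<open>The branch for h = [] is the deletion of x when x alone is the first
    piece.\<close>
  let ?m = "\<lambda>h k. case h of [] \<Rightarrow> F [] k | y # h' \<Rightarrow> F ((x + y) # h') k"
  let ?Fx = "\<lambda>h. F (x # h)"
  have W: "?W F (x # h) k = - ?m h k - ?W ?Fx h k" for h k
    by (cases h) auto
  have "sum_splits (?W F) (x # t) = bar_diff (F []) (x # t) + sum_splits (\<lambda>h k. - ?m h k - ?W ?Fx h k) t"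
    unfolding sum_splits.simps W by simp
  also have "\<dots> = bar_diff (F []) (x # t) - sum_splits ?m t - bar_tail (sum_splits ?Fx) t"
    by (simp only: sum_splits_diff sum_splits_additive[OF additive_uminus] Cons) simp
  also have "\<dots> = bar_tail (sum_splits F) (x # t)"
  proof (cases t)
    case Nil
    then show ?thesis by simp
  next
    case t: (Cons y t')
    show ?thesis unfolding t by (simp add: bar_tail_add)
  qed
  finally show ?case .
qed simp

lemma sum_list_merge:
  fixes hs :: "'h::ab_group_add list"
  assumes "1 \<le> j" "j < length hs"
  shows "sum_list (merge j hs) = sum_list hs"
proof -
  have "hs = take (j - 1) hs @ [hs ! (j - 1), hs ! j] @ drop (j + 1) hs"
    using assms id_take_nth_drop[of "j - 1" hs] Cons_nth_drop_Suc[of j hs] by auto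
  then have "sum_list hs = sum_list (take (j - 1) hs @ [hs ! (j - 1), hs ! j] @ drop (j + 1) hs)"
    by (rule arg_cong)
  then show ?thesis by (simp add: merge_def add.assoc)
qed

locale cycle_set_action = linear_cycle_set dot
  for dot :: "'h::ab_group_add \<Rightarrow> 'h \<Rightarrow> 'h" +
  fixes dia :: "'h \<Rightarrow> 'i::ab_group_add \<Rightarrow> 'i" and lt :: "'i \<Rightarrow> 'h \<Rightarrow> 'i"
  assumes dia_add_right: "dia h (y + y') = dia h y + dia h y'"
    and dia_0_left: "dia 0 y = y"
    and lt_add_right: "lt y (h + h') = lt y h + lt y h'"
    and lt_add_left: "lt (y + y') h = lt y h + lt y' h"
    and dia_add_left: "dia (h + h') y = dia (dot h h') (dia h y)"
    and lt_dia: "lt (dia h y) (dot h h') = dia h (lt y h') + lt (dia h (lt y h)) (dot h h')"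
    and bij_dia: "bij (dia h)"
begin

section \<open>Consequences of the axioms and the operator \<theta>\<close>

lemma additive_dot: "additive (dot a)" and additive_dia: "additive (dia h)"
  and additive_lt_left: "additive (\<lambda>y. lt y h)" and additive_lt_right: "additive (lt y)"
  by (unfold_locales) (rule dot_add_right dia_add_right lt_add_left lt_add_right)+

lemmas dot_0_right [simp] = additive.zero[OF additive_dot]
lemmas lt_0_right [simp] = additive.zero[OF additive_lt_right]

text \<open>\<open>dot 0\<close> is an idempotent bijection, hence the identity.\<close>

lemma dot_0_left [simp]: "dot 0 a = a"
proof -
  have "dot 0 a = dot 0 (dot 0 a)" using dot_add_left[of 0 0 a] by simp
  then show ?thesis using bij_dot[of 0] by (metis bij_pointE)
qed

definition dia_inv :: "'h \<Rightarrow> 'i \<Rightarrow> 'i" where "dia_inv h = inv_into UNIV (dia h)"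

lemma dia_inv_dia [simp]: "dia_inv h (dia h y) = y"
  unfolding dia_inv_def by (rule inv_f_f[OF bij_is_inj[OF bij_dia]])

lemma dia_dia_inv [simp]: "dia h (dia_inv h y) = y"
  unfolding dia_inv_def by (rule surj_f_inv_f[OF bij_is_surj[OF bij_dia]])

lemma dia_inv_eqI: "dia h y = z \<Longrightarrow> dia_inv h z = y" by auto

lemma additive_dia_inv: "additive (dia_inv h)"
  by unfold_locales (rule dia_inv_eqI, simp add: dia_add_right)

lemmas dia_inv_0_right [simp] = additive.zero[OF additive_dia_inv]

lemma dia_inv_0_left [simp]: "dia_inv 0 y = y" by (rule dia_inv_eqI) (rule dia_0_left)

lemma dia_inv_add_left: "dia_inv (h + h') y = dia_inv h (dia_inv (dot h h') y)"
  by (rule dia_inv_eqI) (simp add: dia_add_left)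

text \<open>The operator \<theta> of the overview: the right operation by \<open>dot S k\<close>, as
  in D, conjugated by the action of S.\<close>

definition twisted_lt :: "'h \<Rightarrow> 'h \<Rightarrow> 'i \<Rightarrow> 'i"
  where "twisted_lt S k y = dia_inv S (lt (dia S y) (dot S k))"

lemma additive_twisted_lt: "additive (twisted_lt S k)"
  by unfold_locales (simp add: twisted_lt_def dia_add_right lt_add_left additive.add[OF additive_dia_inv])

lemma twisted_lt_add: "twisted_lt S (k + k') y = twisted_lt S k y + twisted_lt S k' y"
  by (simp add: twisted_lt_def dot_add_right lt_add_right additive.add[OF additive_dia_inv])

text \<open>Handles the first horizontal face, which applies \<open>dot h\<close> to all remaining
  entries.\<close>

lemma twisted_lt_dot: "dia_inv h (twisted_lt (dot h S) (dot h k) y) = twisted_lt (h + S) k (dia_inv h y)"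
  by (simp add: twisted_lt_def dia_inv_add_left dia_add_left dot_add_left)

text \<open>The compatibility axiom \<open>lt_dia\<close> with h = S and h' = k, solved for its
  middle term.\<close>

lemma twisted_lt_minus_lt: "twisted_lt S k (y - lt y S) = lt y k"
proof -
  have "lt (dia S (y - lt y S)) (dot S k) = dia S (lt y k)"
    using lt_dia[of S y k]
    by (simp add: additive.diff[OF additive_dia] additive.diff[OF additive_lt_left])
  then show ?thesis by (simp add: twisted_lt_def)
qed

text \<open>
  The operator \<open>1 - \<rho>\<close> with \<open>\<rho> y = lt y S\<close> has the left inverse \<open>1 + twisted_lt S S\<close>. The latter is
  conjugate to \<open>y \<mapsto> y - lt y (- dot S S)\<close>, which is injective for the same reason, so the left
  inverse is two-sided.
\<close>

lemma add_lt_surj: "\<exists>u. y = u - lt u S"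
proof -
  have left: "(v - lt v S') + twisted_lt S' S' (v - lt v S') = v" for v S'
    by (simp add: twisted_lt_minus_lt)
  have "inj (\<lambda>v. v + twisted_lt S S v)"
  proof (rule injI)
    fix v w
    assume "v + twisted_lt S S v = w + twisted_lt S S w"
    then have "dia S v + lt (dia S v) (dot S S) = dia S w + lt (dia S w) (dot S S)"
      by (metis dia_add_right dia_dia_inv twisted_lt_def)
    then have "dia S v - lt (dia S v) (- dot S S) = dia S w - lt (dia S w) (- dot S S)"
      by (simp add: additive.minus[OF additive_lt_right])
    then have "dia S v = dia S w" using left by metis
    then show "v = w" by (metis dia_inv_dia)
  qed
  moreover have "(\<lambda>v. v + twisted_lt S S v) ((y + twisted_lt S S y) - lt (y + twisted_lt S S y) S)
      = (\<lambda>v. v + twisted_lt S S v) y"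
    using left[of "y + twisted_lt S S y" S] by simp
  ultimately show ?thesis by (metis injD)
qed

text \<open>For y = u - lt u S one gets y - \<theta> y = u - lt u (S + h), so both sides equal lt u
  k.\<close>

lemma twisted_lt_cocycle: "twisted_lt (S + h) k (y - twisted_lt S h y) = twisted_lt S k y"
proof -
  obtain u where u: "y = u - lt u S" using add_lt_surj by blast
  have "y - twisted_lt S h y = u - lt u (S + h)"
    by (simp add: u twisted_lt_minus_lt lt_add_right)
  then have "twisted_lt (S + h) k (y - twisted_lt S h y) = lt u k"
    by (simp only: twisted_lt_minus_lt)
  then show ?thesis unfolding u by (simp only: twisted_lt_minus_lt)
qed

text \<open>The horizontal differential after twisting: the action has moved from the last face to
  the first, as \<open>dia_inv x\<close>. It acts on functions of arbitrary pairs of words, so a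
  whole total cochain is treated as one function.\<close>

fun hor_diff :: "('h list \<Rightarrow> 'h list \<Rightarrow> 'i) \<Rightarrow> 'h list \<Rightarrow> 'h list \<Rightarrow> 'i" where
  "hor_diff F [] ks = 0"
| "hor_diff F (x # hs) ks = dia_inv x (F (map (dot x) hs) (map (dot x) ks)) + bar_tail (\<lambda>h. F h ks) (x # hs)"

definition ver_diff :: "('h list \<Rightarrow> 'h list \<Rightarrow> 'i) \<Rightarrow> 'h list \<Rightarrow> 'h list \<Rightarrow> 'i" where
  "ver_diff F hs ks = alt (length hs) (bar_diff (F hs) ks)"

text \<open>The twisted D, supported on pairs whose second word is one letter.\<close>

definition edge_diff :: "('h list \<Rightarrow> 'h list \<Rightarrow> 'i) \<Rightarrow> 'h list \<Rightarrow> 'h list \<Rightarrow> 'i" where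
  "edge_diff F hs ks = (case ks of [k] \<Rightarrow> alt (length hs) (twisted_lt (sum_list hs) k (sum_splits F hs)) | _ \<Rightarrow> 0)"

definition full_diff :: "('h list \<Rightarrow> 'h list \<Rightarrow> 'i) \<Rightarrow> 'h list \<Rightarrow> 'h list \<Rightarrow> 'i" where
  "full_diff F hs ks = hor_diff F hs ks + ver_diff F hs ks + edge_diff F hs ks"

section \<open>Additivity and locality of the differentials\<close>

lemma hor_diff_add: "hor_diff (\<lambda>h k. F h k + G h k) hs ks = hor_diff F hs ks + hor_diff G hs ks"
  by (cases hs) (auto simp: bar_tail_add additive.add[OF additive_dia_inv])

lemma hor_diff_cong:
  assumes "\<And>h k. length k = length ks \<Longrightarrow> Suc (length h) = length hs \<Longrightarrow> F h k = G h k"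
  shows "hor_diff F hs ks = hor_diff G hs ks"
  using assms by (cases hs) (auto intro!: bar_tail_cong arg_cong2[where f = "(+)"] arg_cong[where f = "dia_inv _"])

lemma ver_diff_add: "ver_diff (\<lambda>h k. F h k + G h k) hs ks = ver_diff F hs ks + ver_diff G hs ks"
  by (simp add: ver_diff_def bar_diff_add alt_add)

lemma ver_diff_cong:
  assumes "\<And>h k. length h = length hs \<Longrightarrow> Suc (length k) = length ks \<Longrightarrow> F h k = G h k"
  shows "ver_diff F hs ks = ver_diff G hs ks"
  unfolding ver_diff_def using assms by (simp cong: bar_diff_cong)

lemma edge_diff_add: "edge_diff (\<lambda>h k. F h k + G h k) hs ks = edge_diff F hs ks + edge_diff G hs ks"
  by (auto simp: edge_diff_def sum_splits_add additive.add[OF additive_twisted_lt] alt_add split: list.split)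

lemma edge_diff_cong:
  assumes "\<And>h k. k \<noteq> [] \<Longrightarrow> Suc (length h + length k) = length hs + length ks \<Longrightarrow> F h k = G h k"
  shows "edge_diff F hs ks = edge_diff G hs ks"
proof (cases "length ks = 1")
  case True
  then have "sum_splits F hs = sum_splits G hs" by (intro sum_splits_cong assms) auto
  then show ?thesis by (simp add: edge_diff_def split: list.split)
next
  case False
  then show ?thesis by (auto simp: edge_diff_def split: list.split)
qed

lemma full_diff_add: "full_diff (\<lambda>h k. F h k + G h k) hs ks = full_diff F hs ks + full_diff G hs ks"
  by (simp add: full_diff_def hor_diff_add ver_diff_add edge_diff_add)

lemma full_diff_cong:
  assumes "\<And>h k. Suc (length h + length k) = length hs + length ks \<Longrightarrow> F h k = G h k"
  shows "full_diff F hs ks = full_diff G hs ks"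
  unfolding full_diff_def
  by (intro arg_cong2[where f = "(+)"] hor_diff_cong ver_diff_cong edge_diff_cong assms) auto

text \<open>The bar faces cancel among themselves. Applying the first face twice gives the first
  face for x + y, by \<open>dia_inv_add_left\<close> and \<open>dot_add_left\<close>, which cancels
  the merge of x and y.\<close>

lemma hor_diff_hor_diff: "hor_diff (hor_diff F) hs ks = 0"
proof (cases hs)
  case Nil
  then show ?thesis by simp
next
  case (Cons x t)
  show ?thesis
  proof (cases t)
    case Nil
    then show ?thesis using Cons by simp
  next
    case t: (Cons y t')
    let ?d = "dot x"
    let ?A = "\<lambda>w. dia_inv x (F (map ?d w) (map ?d ks))"
    have d: "map (dot (x + y)) l = map (dot (?d y)) (map ?d l)" for l
      by (simp add: dot_add_left)
    have A: "bar_tail ?A t = dia_inv x (bar_tail (\<lambda>h. F h (map ?d ks)) (map ?d t))"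
      by (simp only: bar_tail_additive[OF additive_dia_inv] bar_tail_map[OF additive_dot])
    have 1: "dia_inv x (hor_diff F (map ?d t) (map ?d ks))
       = dia_inv (x + y) (F (map (dot (x + y)) t') (map (dot (x + y)) ks)) + bar_tail ?A t"
      unfolding A d dia_inv_add_left
      by (simp add: t additive.add[OF additive_dia_inv] del: map_map)
    have 2: "bar_tail (\<lambda>h. hor_diff F h ks) (x # t)
      = - dia_inv (x + y) (F (map (dot (x + y)) t') (map (dot (x + y)) ks)) - bar_tail ?A t
        + bar_tail (bar_tail (\<lambda>h. F h ks)) (x # t)"
      by (simp add: t bar_tail_add del: bar_tail_bar_tail)
    show ?thesis unfolding Cons hor_diff.simps 1 2 by simp
  qed
qed

text \<open>The operators act on different words and commute up to the sign in
  \<open>ver_diff\<close>, which changes with the length of hs.\<close>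

lemma hor_diff_ver_diff: "hor_diff (ver_diff F) hs ks + ver_diff (hor_diff F) hs ks = 0"
proof (cases hs)
  case Nil
  have "hor_diff F [] = (\<lambda>k. 0)" by auto
  then show ?thesis by (simp add: Nil ver_diff_def)
next
  case (Cons x t)
  have h: "hor_diff F (x # t)
      = (\<lambda>ks. dia_inv x (F (map (dot x) t) (map (dot x) ks)) + bar_tail (\<lambda>h. F h ks) (x # t))"
    by auto
  have "bar_tail (\<lambda>h. ver_diff F h ks) hs = bar_tail (\<lambda>h. alt (length t) (bar_diff (F h) ks)) hs"
    by (rule bar_tail_cong) (simp add: Cons ver_diff_def)
  also have "\<dots> = alt (length t) (bar_diff (\<lambda>w. bar_tail (\<lambda>h. F h w) hs) ks)"
    by (simp only: bar_tail_additive[OF additive_alt] bar_diff_bar_tail)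
  finally show ?thesis
    unfolding Cons ver_diff_def h
    by (simp add: Cons ver_diff_def bar_diff_add bar_diff_additive[OF additive_dia_inv] alt_add
        additive.alt[OF additive_dia_inv] bar_diff_map[OF additive_dot])
qed

lemma ver_diff_ver_diff: "ver_diff (ver_diff F) hs ks = 0"
proof -
  have "ver_diff F hs = (\<lambda>ks. alt (length hs) (bar_diff (F hs) ks))"
    by (auto simp: ver_diff_def)
  then show ?thesis by (simp add: ver_diff_def bar_diff_additive[OF additive_alt])
qed

text \<open>On \<open>[a, b]\<close> the faces are b, a + b and a, and \<theta> is additive in this
  entry.\<close>

lemma ver_diff_edge_diff: "ver_diff (edge_diff F) hs ks = 0"
proof (cases "length ks = 2")
  case True
  then obtain a b where "ks = [a, b]" by (metis One_nat_def Suc_1 length_0_conv length_Suc_conv)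
  then show ?thesis by (simp add: ver_diff_def edge_diff_def twisted_lt_add alt_add)
next
  case False
  have "ver_diff (edge_diff F) hs ks = ver_diff (\<lambda>h k. 0) hs ks"
    by (rule ver_diff_cong) (use False in \<open>auto simp: edge_diff_def split: list.split\<close>)
  then show ?thesis by (simp add: ver_diff_def)
qed

lemma sum_splits_hor_ver:
  "sum_splits (\<lambda>h k. hor_diff F h k + ver_diff F h k) (x # t)
   = dia_inv x (sum_splits F (map (dot x) t)) + bar_tail (sum_splits F) (x # t)"
proof -
  let ?A = "\<lambda>h k. case h of [] \<Rightarrow> 0 | x # h' \<Rightarrow> dia_inv x (F (map (dot x) h') (map (dot x) k))"
  have "hor_diff F h k + ver_diff F h k
     = ?A h k + (bar_tail (\<lambda>w. F w k) h + alt (length h) (bar_diff (F h) k))" for h k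
    by (cases h) (auto simp: ver_diff_def)
  then have "sum_splits (\<lambda>h k. hor_diff F h k + ver_diff F h k) (x # t)
    = sum_splits ?A (x # t) + bar_tail (sum_splits F) (x # t)"
    unfolding sum_splits_bar[symmetric] by (simp only: sum_splits_add)
  then show ?thesis
    by (simp add: sum_splits_additive[OF additive_dia_inv] sum_splits_map)
qed

text \<open>The first face and the merges cancel between the two summands because they involve the
  same \<theta>. Deleting the last letter changes S to S'; the D D term makes up for this by
  \<open>twisted_lt_cocycle\<close>.\<close>

lemma edge_diff_full_diff: "hor_diff (edge_diff F) hs ks + edge_diff (full_diff F) hs ks = 0"
proof (cases "length ks = 1 \<and> hs \<noteq> []")
  case False
  show ?thesis
  proof (cases "hs = []")
    case True
    then show ?thesis by (auto simp: edge_diff_def additive.zero[OF additive_twisted_lt] split: list.split)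
  next
    case hs: False
    then have "hor_diff (edge_diff F) hs ks = hor_diff (\<lambda>h k. 0) hs ks"
      by (intro hor_diff_cong) (use False in \<open>auto simp: edge_diff_def split: list.split\<close>)
    moreover have "hor_diff (\<lambda>h k. 0) hs ks = 0" by (cases hs) auto
    moreover have "edge_diff (full_diff F) hs ks = 0"
      using False hs by (auto simp: edge_diff_def split: list.split)
    ultimately show ?thesis by simp
  qed
next
  case True
  then obtain k where ks: "ks = [k]" by (metis One_nat_def length_0_conv length_Suc_conv)
  obtain x t where hs: "hs = x # t" using True by (cases hs) auto
  let ?n = "length t" and ?S = "sum_list hs" and ?S' = "sum_list (butlast hs)"
  let ?U = "sum_splits F"
  let ?y = "?U (butlast hs)"
  let ?a = "dia_inv x (?U (map (dot x) t))" and ?M = "\<Sum>j\<in>{1..?n}. alt j (?U (merge j hs))"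
  have last: "butlast hs @ [last hs] = hs" using True by simp
  have S: "?S = ?S' + last hs" using arg_cong[OF last, of sum_list] by (simp del: append_butlast_last_id)
  have len: "length hs = Suc ?n" "length (butlast hs) = ?n" by (auto simp: hs)
  \<comment> \<open>Merging keeps the sum S, so \<theta> can be pulled out of the sum over
    merges.\<close>
  have merge: "sum_list (merge j hs) = ?S" if "j \<in> {1..?n}" for j
    by (rule sum_list_merge) (use that len in auto)
  have 1: "sum_splits (full_diff F) hs
     = ?a + ?M + alt (Suc ?n) ?y + alt ?n (twisted_lt ?S' (last hs) ?y)"
  proof -
    have "sum_splits (full_diff F) hs
      = sum_splits (\<lambda>h k. hor_diff F h k + ver_diff F h k) hs + sum_splits (edge_diff F) hs"
      unfolding full_diff_def[abs_def] by (rule sum_splits_add)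
    moreover have "sum_splits (edge_diff F) hs = alt ?n (twisted_lt ?S' (last hs) ?y)"
      using sum_splits_last[of "\<lambda>h z. alt (length h) (twisted_lt (sum_list h) z (sum_splits F h))"
          "butlast hs" "last hs"]
      unfolding last edge_diff_def[abs_def] len(2) by simp
    moreover have "sum_splits (\<lambda>h k. hor_diff F h k + ver_diff F h k) hs = ?a + bar_tail ?U hs"
      unfolding hs by (rule sum_splits_hor_ver)
    ultimately show ?thesis by (simp add: bar_tail_eq_sum[OF len(1)] add.assoc)
  qed
  have 2: "hor_diff (edge_diff F) hs ks = alt ?n (twisted_lt ?S k ?a)
     + (alt ?n (twisted_lt ?S k ?M) + alt (Suc ?n) (alt ?n (twisted_lt ?S' k ?y)))"
  proof -
    have "bar_tail (\<lambda>h. edge_diff F h ks) hs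
      = bar_tail (\<lambda>h. alt ?n (twisted_lt (sum_list h) k (?U h))) hs"
      by (rule bar_tail_cong) (simp add: ks len edge_diff_def)
    also have "\<dots> = (\<Sum>j\<in>{1..?n}. alt j (alt ?n (twisted_lt ?S k (?U (merge j hs)))))
        + alt (Suc ?n) (alt ?n (twisted_lt ?S' k ?y))"
      unfolding bar_tail_eq_sum[OF len(1)] using merge by simp
    also have "(\<Sum>j\<in>{1..?n}. alt j (alt ?n (twisted_lt ?S k (?U (merge j hs))))) = alt ?n (twisted_lt ?S k ?M)"
      by (simp add: additive.sum[OF additive_twisted_lt] additive.alt[OF additive_twisted_lt] alt_sum alt_alt add.commute)
    finally have B: "bar_tail (\<lambda>h. edge_diff F h ks) hs
        = alt ?n (twisted_lt ?S k ?M) + alt (Suc ?n) (alt ?n (twisted_lt ?S' k ?y))" .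
    have "sum_list (map (dot x) t) = dot x (sum_list t)" for x
      by (induction t) (auto simp: dot_add_right)
    then have "dia_inv x (edge_diff F (map (dot x) t) (map (dot x) ks)) = alt ?n (twisted_lt ?S k ?a)"
      by (simp add: edge_diff_def ks additive.alt[OF additive_dia_inv] twisted_lt_dot hs)
    then show ?thesis using B unfolding hs by simp
  qed
  have 3: "edge_diff (full_diff F) hs ks = - alt ?n (twisted_lt ?S k (sum_splits (full_diff F) hs))"
    by (simp add: edge_diff_def ks len)
  \<comment> \<open>The cocycle identity at S' with h the last letter; its last term is what D D
    contributes.\<close>
  have 4: "twisted_lt ?S' k ?y = twisted_lt ?S k ?y - twisted_lt ?S k (twisted_lt ?S' (last hs) ?y)"
    unfolding S twisted_lt_cocycle[of ?S' "last hs" k ?y, symmetric]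
    by (rule additive.diff[OF additive_twisted_lt])
  show ?thesis
    unfolding 1 2 3 4
    by (simp add: additive.add[OF additive_twisted_lt] additive.diff[OF additive_twisted_lt]
        additive.minus[OF additive_twisted_lt] additive.alt[OF additive_twisted_lt] alt_add alt_diff alt_minus alt_alt)
qed

theorem full_diff_full_diff: "full_diff (full_diff F) hs ks = 0"
proof -
  have h: "hor_diff (full_diff F) hs ks
     = hor_diff (hor_diff F) hs ks + hor_diff (ver_diff F) hs ks + hor_diff (edge_diff F) hs ks"
    unfolding full_diff_def[abs_def] by (simp only: hor_diff_add)
  have v: "ver_diff (full_diff F) hs ks
     = ver_diff (hor_diff F) hs ks + ver_diff (ver_diff F) hs ks + ver_diff (edge_diff F) hs ks"
    unfolding full_diff_def[abs_def] by (simp only: ver_diff_add)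
  show ?thesis
    unfolding full_diff_def[of "full_diff F"] h v
    using hor_diff_ver_diff[of F hs ks] edge_diff_full_diff[of F hs ks]
    by (simp add: hor_diff_hor_diff ver_diff_ver_diff ver_diff_edge_diff algebra_simps)
qed

end

section \<open>The total differential\<close>

lemma shuffle_vanishing_cong:
  assumes "\<And>hs ks. length hs = r \<Longrightarrow> length ks = s \<Longrightarrow> F hs ks = G hs ks" "shuffle_vanishing r s G"
  shows "shuffle_vanishing r s F"
  unfolding shuffle_vanishing_def
proof (intro allI impI)
  fix hs xs ys :: "'a list"
  assume *: "length hs = r" "xs \<noteq> []" "ys \<noteq> []" "length xs + length ys = s"
  have "shuffle_eval (\<lambda>w. F hs (rev w)) xs ys = shuffle_eval (\<lambda>w. G hs (rev w)) xs ys"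
    by (rule shuffle_eval_cong) (use assms(1) * in auto)
  also have "\<dots> = 0" by (rule shuffle_vanishingD[OF assms(2) *])
  finally show "shuffle_eval (\<lambda>w. F hs (rev w)) xs ys = 0" .
qed

lemma degenerate_vanishing_cong:
  assumes "\<And>hs ks. length hs = r \<Longrightarrow> length ks = s \<Longrightarrow> F hs ks = G hs ks" "degenerate_vanishing r s G"
  shows "degenerate_vanishing r s F"
  using assms by (auto simp: degenerate_vanishing_def)

lemma shuffle_vanishing_additive:
  assumes "\<And>hs. additive (p hs)" "shuffle_vanishing r s F"
  shows "shuffle_vanishing r s (\<lambda>hs ks. p hs (F hs ks))"
  using assms(2) by (auto simp: shuffle_vanishing_def shuffle_eval_additive[OF assms(1)] additive.zero[OF assms(1)])

lemma degenerate_vanishing_additive: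
  assumes "\<And>hs. additive (p hs)" "degenerate_vanishing r s F"
  shows "degenerate_vanishing r s (\<lambda>hs ks. p hs (F hs ks))"
  using assms(2) by (auto simp: degenerate_vanishing_def additive.zero[OF assms(1)])

text \<open>No two nonempty words have total length one, so D can take any values in M(1).\<close>

lemma shuffle_vanishing_1: "shuffle_vanishing r (Suc 0) F"
  by (auto simp: shuffle_vanishing_def neq_Nil_conv)

lemma carrier_C_total: "carrier (C_total n) = (\<Pi>\<^sub>E r\<in>{0..<n}. carrier (C_bigr r (n - r)))"
  unfolding C_total_def by (subst carrier_sum_group) auto

lemma comm_group_C_total: "comm_group (C_total n)"
proof (rule group.group_comm_groupI)
  show "group (C_total n)" unfolding C_total_def by (rule sum_group) simp
next
  fix x y :: "nat \<Rightarrow> 'a chain \<Rightarrow> 'b" assume "x \<in> carrier (C_total n)" "y \<in> carrier (C_total n)"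
  then have "x r \<otimes>\<^bsub>C_bigr r (n - r)\<^esub> y r = y r \<otimes>\<^bsub>C_bigr r (n - r)\<^esub> x r" if "r \<in> {0..<n}" for r
    using that comm_group.axioms(1)[OF comm_group_C_bigr] by (auto simp: carrier_C_total intro!: comm_monoid.m_comm)
  then show "x \<otimes>\<^bsub>C_total n\<^esub> y = y \<otimes>\<^bsub>C_total n\<^esub> x"
    by (auto simp: C_total_def)
qed

context cycle_set_action
begin

definition twist :: "('h list \<Rightarrow> 'h list \<Rightarrow> 'i) \<Rightarrow> 'h list \<Rightarrow> 'h list \<Rightarrow> 'i"
  where "twist F hs ks = dia_inv (sum_list hs) (F hs ks)"

lemma dia_twist [simp]: "dia (sum_list hs) (twist F hs ks) = F hs ks"
  by (simp add: twist_def)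

lemma sum_list_map_dot: "sum_list (map (dot x) hs) = dot x (sum_list hs)"
  by (induction hs) (auto simp: dot_add_right)

text \<open>With S' the sum before the last letter h, the action of S is that of
  \<open>dot S' h\<close> after that of S'; this absorbs R into the twist on the last face. The same
  rule for S = x + (sum of t) produces \<open>dia_inv x\<close> on the first.\<close>

lemma hor_formula:
  assumes "length hs = Suc r"
  shows "F (map (dot (hd hs)) (tl hs)) (map (dot (hd hs)) ks)
    + (\<Sum>j\<in>{1..r}. alt j (F (merge j hs) ks))
    + alt (r + 1) (dia (R_map dot (take r hs) (drop r hs)) (F (take r hs) ks))
    = dia (sum_list hs) (hor_diff (twist F) hs ks)"
proof -
  obtain x t where hs: "hs = x # t" using assms by (cases hs) auto
  let ?S = "sum_list hs"
  have 1: "F (map (dot x) t) (map (dot x) ks)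
      = dia ?S (dia_inv x (twist F (map (dot x) t) (map (dot x) ks)))"
    using dia_twist[of "map (dot x) t" F "map (dot x) ks"]
    by (simp add: hs dia_add_left sum_list_map_dot del: dia_twist)
  have 2: "F (merge j hs) ks = dia ?S (twist F (merge j hs) ks)" if "j \<in> {1..r}" for j
    using dia_twist[of "merge j hs" F ks] that assms by (simp add: sum_list_merge del: dia_twist)
  have b: "take r hs = butlast hs" "drop r hs = [last hs]"
    using assms by (simp_all add: butlast_conv_take) (cases hs rule: rev_cases; simp)
  have "butlast hs @ [last hs] = hs" by (simp add: hs)
  then have "?S = sum_list (butlast hs @ [last hs])" by simp
  then have S: "?S = sum_list (butlast hs) + last hs" by (simp del: append_butlast_last_id)
  have 3: "dia (R_map dot (take r hs) (drop r hs)) (F (take r hs) ks) = dia ?S (twist F (butlast hs) ks)"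
    by (simp add: b R_map_def S dia_add_left)
  have "dia ?S (hor_diff (twist F) hs ks)
     = dia ?S (dia_inv x (twist F (map (dot x) t) (map (dot x) ks)))
       + dia ?S (bar_tail (\<lambda>h. twist F h ks) hs)"
    by (simp add: hs dia_add_right)
  also have "dia ?S (bar_tail (\<lambda>h. twist F h ks) hs)
     = (\<Sum>j\<in>{1..r}. alt j (F (merge j hs) ks)) + alt (Suc r) (dia ?S (twist F (butlast hs) ks))"
    unfolding bar_tail_eq_sum[OF assms] additive.add[OF additive_dia] additive.sum[OF additive_dia]
      additive.alt[OF additive_dia] using 2 by simp
  finally show ?thesis unfolding 3 1[symmetric] by (simp add: hs add.assoc)
qed

lemma ver_formula:
  assumes "length hs = r" "length ks = Suc s"
  shows "alt r (F hs (tl ks)) + (\<Sum>j\<in>{r+1..r+s}. alt j (F hs (merge (j - r) ks)))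
    + alt (r + s + 1) (F hs (butlast ks)) = dia (sum_list hs) (ver_diff (twist F) hs ks)"
proof -
  have "(\<Sum>j\<in>{r+1..r+s}. alt j (F hs (merge (j - r) ks))) = (\<Sum>j\<in>{1..s}. alt (r + j) (F hs (merge j ks)))"
    by (rule sum.reindex_bij_witness[of _ "\<lambda>j. r + j" "\<lambda>j. j - r"]) auto
  moreover have "dia (sum_list hs) (ver_diff (twist F) hs ks) = alt r (bar_diff (F hs) ks)"
    unfolding ver_diff_def assms(1) additive.alt[OF additive_dia]
      bar_diff_additive[OF additive_dia, symmetric] by simp
  ultimately show ?thesis
    unfolding bar_diff_eq_sum[OF assms(2)] alt_add alt_sum alt_alt by (simp add: add.assoc)
qed

text \<open>The action of R following the twist of the first r letters is the twist of all letters,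
  so every component is acted on by the same S.\<close>

lemma edge_formula:
  "lt (alt n (dia (R_map dot (take r hs) (drop r hs)) (F (take r hs) (drop r hs)))) (R_map dot hs [k])
    = dia (sum_list hs) (alt n (twisted_lt (sum_list hs) k (twist F (take r hs) (drop r hs))))"
proof -
  have "sum_list hs = sum_list (take r hs) + sum_list (drop r hs)"
    by (metis append_take_drop_id sum_list_append)
  then have "dia (R_map dot (take r hs) (drop r hs)) (F (take r hs) (drop r hs))
      = dia (sum_list hs) (twist F (take r hs) (drop r hs))"
    by (simp add: R_map_def dia_add_left)
  then show ?thesis
    by (simp add: R_map_def additive.alt[OF additive_dia] additive.alt[OF additive_lt_left] twisted_lt_def)
qed

text \<open>Each face leaves the second word alone or applies \<open>dot x\<close> letter by letter,
  and both operations commute with shuffling.\<close>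

lemma shuffle_vanishing_hor_diff:
  assumes "shuffle_vanishing r s F" shows "shuffle_vanishing (Suc r) s (hor_diff F)"
  unfolding shuffle_vanishing_def
proof (intro allI impI)
  fix hs xs ys :: "'h list"
  assume *: "length hs = Suc r" "xs \<noteq> []" "ys \<noteq> []" "length xs + length ys = s"
  obtain x t where hs: "hs = x # t" using * by (cases hs) auto
  have "shuffle_eval (\<lambda>w. hor_diff F hs (rev w)) xs ys
      = dia_inv x (shuffle_eval (\<lambda>w. F (map (dot x) t) (rev w)) (map (dot x) xs) (map (dot x) ys))
        + bar_tail (\<lambda>h. shuffle_eval (\<lambda>w. F h (rev w)) xs ys) hs"
    by (simp add: hs shuffle_eval_add shuffle_eval_bar_tail shuffle_eval_additive[OF additive_dia_inv]
        shuffle_eval_map rev_map)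
  also have "\<dots> = bar_tail (\<lambda>h. shuffle_eval (\<lambda>w. F h (rev w)) xs ys) hs"
    using shuffle_vanishingD[OF assms, of "map (dot x) t" "map (dot x) xs" "map (dot x) ys"] * hs by simp
  also have "\<dots> = bar_tail (\<lambda>h. 0) hs"
    by (rule bar_tail_cong) (use shuffle_vanishingD[OF assms] * in auto)
  finally show "shuffle_eval (\<lambda>w. hor_diff F hs (rev w)) xs ys = 0" by simp
qed

lemma degenerate_vanishing_hor_diff:
  assumes "degenerate_vanishing r s F" shows "degenerate_vanishing (Suc r) s (hor_diff F)"
  unfolding degenerate_vanishing_def
proof (intro allI impI)
  fix hs ks :: "'h list"
  assume len: "length hs = Suc r" "length ks = s" and 0: "0 \<in> set hs \<union> set ks"
  note D = degenerate_vanishingD[OF assms _ len(2)]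
  obtain x t where hs: "hs = x # t" and t: "length t = r" using len by (cases hs) auto
  have m: "0 \<in> set (map (dot x) l)" if "0 \<in> set l" for l
    using imageI[OF that, of "dot x"] by simp
  consider "0 \<in> set ks" | "0 \<in> set t" | "x = 0" using 0 hs by auto
  then show "hor_diff F hs ks = 0"
  proof cases
    case 1
    have "bar_tail (\<lambda>h. F h ks) hs = bar_tail (\<lambda>h. 0) hs"
      by (rule bar_tail_cong) (use D 1 len in auto)
    moreover have "F (map (dot x) t) (map (dot x) ks) = 0"
      by (rule degenerate_vanishingD[OF assms]) (use m[OF 1] t len in auto)
    ultimately show ?thesis by (simp add: hs)
  next
    case 2
    have "bar_tail (\<lambda>h. F h ks) hs = 0"
      unfolding hs by (rule bar_tail_zero_later) (use D 2 t in auto)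
    moreover have "F (map (dot x) t) (map (dot x) ks) = 0"
      by (rule degenerate_vanishingD[OF assms]) (use m[OF 2] t len in auto)
    ultimately show ?thesis by (simp add: hs)
  next
    case 3
    \<comment> \<open>For x = 0 both \<open>dot 0\<close> and \<open>dia_inv 0\<close> are
      identities, so the first face is F t ks and cancels this term.\<close>
    have "bar_tail (\<lambda>h. F h ks) (0 # t) = - F t ks"
      by (rule bar_tail_zero_first) (use D t in auto)
    moreover have "map (dot 0) l = l" for l by (simp add: map_idI)
    ultimately show ?thesis by (simp add: hs 3)
  qed
qed

text \<open>The Leibniz rule is applied to reversed words; \<open>bar_diff_rev\<close> changes only
  the sign.\<close>

lemma shuffle_vanishing_ver_diff:
  assumes "shuffle_vanishing r s F" shows "shuffle_vanishing r (Suc s) (ver_diff F)"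
  unfolding shuffle_vanishing_def
proof (intro allI impI)
  fix hs xs ys :: "'h list"
  assume *: "length hs = r" "xs \<noteq> []" "ys \<noteq> []" "length xs + length ys = Suc s"
  have "shuffle_eval (\<lambda>w. ver_diff F hs (rev w)) xs ys
      = shuffle_eval (\<lambda>w. alt r (alt (Suc s) (bar_diff (\<lambda>w. F hs (rev w)) w))) xs ys"
    by (rule shuffle_eval_cong) (simp add: ver_diff_def bar_diff_rev * del: alt_Suc)
  also have "\<dots> = alt r (alt (Suc s) (shuffle_eval (bar_diff (\<lambda>w. F hs (rev w))) xs ys))"
    by (simp only: shuffle_eval_additive[OF additive_alt])
  also have "shuffle_eval (bar_diff (\<lambda>w. F hs (rev w))) xs ys = 0"
    by (rule shuffle_eval_bar_diff_vanishing[OF _ *(2-)]) (rule shuffle_vanishingD[OF assms *(1)])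
  finally show "shuffle_eval (\<lambda>w. ver_diff F hs (rev w)) xs ys = 0" by simp
qed

lemma degenerate_vanishing_ver_diff:
  assumes "degenerate_vanishing r s F" shows "degenerate_vanishing r (Suc s) (ver_diff F)"
  unfolding degenerate_vanishing_def
proof (intro allI impI)
  fix hs ks :: "'h list"
  assume len: "length hs = r" "length ks = Suc s" and 0: "0 \<in> set hs \<union> set ks"
  have "bar_diff (F hs) ks = 0"
  proof (cases "0 \<in> set hs")
    case True
    have "bar_diff (F hs) ks = bar_diff (\<lambda>w. 0) ks"
      by (rule bar_diff_cong) (use degenerate_vanishingD[OF assms len(1)] True len in auto)
    then show ?thesis by simp
  next
    case False
    then show ?thesis
      by (intro bar_diff_degenerate) (use degenerate_vanishingD[OF assms len(1)] 0 len in auto)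
  qed
  then show "ver_diff F hs ks = 0" by (simp add: ver_diff_def)
qed

lemma degenerate_vanishing_edge:
  assumes "degenerate_vanishing r s F"
  shows "degenerate_vanishing (r + s) 1
    (\<lambda>hs ks. alt (r + s) (twisted_lt (sum_list hs) (hd ks) (F (take r hs) (drop r hs))))"
  unfolding degenerate_vanishing_def
proof (intro allI impI)
  fix hs ks :: "'h list"
  assume len: "length hs = r + s" "length ks = 1" and 0: "0 \<in> set hs \<union> set ks"
  have "twisted_lt (sum_list hs) (hd ks) (F (take r hs) (drop r hs)) = 0"
  proof (cases "0 \<in> set hs")
    case True
    then have "0 \<in> set (take r hs) \<union> set (drop r hs)" by (metis append_take_drop_id set_append)
    then have "F (take r hs) (drop r hs) = 0"
      by (intro degenerate_vanishingD[OF assms]) (use len in auto)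
    then show ?thesis by (simp add: additive.zero[OF additive_twisted_lt])
  next
    case False
    then have "hd ks = 0" using len 0 by (cases ks) auto
    then show ?thesis by (simp add: twisted_lt_def)
  qed
  then show "alt (r + s) (twisted_lt (sum_list hs) (hd ks) (F (take r hs) (drop r hs))) = 0" by simp
qed

text \<open>The twist is additive and depends on hs alone, so the vanishing conditions can be
  checked on G.\<close>

lemma cochain_with_values_twist:
  assumes eq: "\<And>hs ks. length hs = r \<Longrightarrow> length ks = s \<Longrightarrow> F hs ks = dia (sum_list hs) (G hs ks)"
    and G: "shuffle_vanishing r s G" "degenerate_vanishing r s G"
  shows "cochain_with_values r s F \<in> carrier (C_bigr r s)"
    and "length hs = r \<Longrightarrow> length ks = s \<Longrightarrow> twist (value_at (cochain_with_values r s F)) hs ks = G hs ks"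
proof -
  have "shuffle_vanishing r s F" "degenerate_vanishing r s F"
    using shuffle_vanishing_cong[OF eq shuffle_vanishing_additive[OF additive_dia G(1)]]
      degenerate_vanishing_cong[OF eq degenerate_vanishing_additive[OF additive_dia G(2)]] by blast+
  note * = cochain_with_values_full[OF this]
  show "cochain_with_values r s F \<in> carrier (C_bigr r s)" by (rule *(1))
  show "twist (value_at (cochain_with_values r s F)) hs ks = G hs ks" if "length hs = r" "length ks = s"
    using *(2)[OF that] eq[OF that] by (simp add: twist_def)
qed

lemma twist_value_at_vanishing:
  assumes "f \<in> carrier (C_bigr r s)"
  shows "shuffle_vanishing r s (twist (value_at f))" "degenerate_vanishing r s (twist (value_at f))"
  unfolding twist_def[abs_def]
  by (rule shuffle_vanishing_additive[OF additive_dia_inv shuffle_vanishing_value_at[OF assms]],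
      rule degenerate_vanishing_additive[OF additive_dia_inv degenerate_vanishing_value_at])

lemma d_hor:
  assumes f: "f \<in> carrier (C_bigr r s)"
  shows "d_hor dot dia r s f \<in> carrier (C_bigr (Suc r) s)"
    and "length hs = Suc r \<Longrightarrow> length ks = s \<Longrightarrow>
      twist (value_at (d_hor dot dia r s f)) hs ks = hor_diff (twist (value_at f)) hs ks"
  unfolding d_hor_def Suc_eq_plus1[symmetric]
  by (rule cochain_with_values_twist[OF hor_formula[unfolded Suc_eq_plus1[symmetric]]
        shuffle_vanishing_hor_diff degenerate_vanishing_hor_diff];
      (rule twist_value_at_vanishing[OF f] | assumption))+

lemma d_ver:
  assumes f: "f \<in> carrier (C_bigr r s)"
  shows "d_ver r s f \<in> carrier (C_bigr r (Suc s))"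
    and "length hs = r \<Longrightarrow> length ks = Suc s \<Longrightarrow>
      twist (value_at (d_ver r s f)) hs ks = ver_diff (twist (value_at f)) hs ks"
  unfolding d_ver_def Suc_eq_plus1[symmetric]
  by (rule cochain_with_values_twist[OF ver_formula[unfolded Suc_eq_plus1[symmetric]]
        shuffle_vanishing_ver_diff degenerate_vanishing_ver_diff];
      (rule twist_value_at_vanishing[OF f] | assumption))+

lemma D_comp:
  assumes f: "f \<in> carrier (C_bigr r s)"
  shows "D_comp dot dia lt r s f \<in> carrier (C_bigr (r + s) 1)"
    and "length hs = r + s \<Longrightarrow> twist (value_at (D_comp dot dia lt r s f)) hs [k]
      = alt (r + s) (twisted_lt (sum_list hs) k (twist (value_at f) (take r hs) (drop r hs)))"
proof -
  have eq: "lt (alt (r + s) (dia (R_map dot (take r hs) (drop r hs)) (value_at f (take r hs) (drop r hs))))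
      (R_map dot hs ks) = dia (sum_list hs)
        (alt (r + s) (twisted_lt (sum_list hs) (hd ks) (twist (value_at f) (take r hs) (drop r hs))))"
    if "length ks = 1" for hs ks
    using edge_formula[of "r + s" r hs "value_at f" "hd ks"] that by (cases ks) auto
  have sh: "shuffle_vanishing (r + s) 1 F" for F :: "'h list \<Rightarrow> 'h list \<Rightarrow> 'i"
    using shuffle_vanishing_1 by simp
  note * = cochain_with_values_twist[OF eq sh degenerate_vanishing_edge[OF twist_value_at_vanishing(2)[OF f]],
      folded D_comp_def]
  show "D_comp dot dia lt r s f \<in> carrier (C_bigr (r + s) 1)" by (rule *(1))
  show "twist (value_at (D_comp dot dia lt r s f)) hs [k]
      = alt (r + s) (twisted_lt (sum_list hs) k (twist (value_at f) (take r hs) (drop r hs)))"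
    if "length hs = r + s"
    using *(2)[OF _ that, of "[k]"] by simp
qed

lemma twist_value_at_mult:
  "length hs = r \<Longrightarrow> length ks = s \<Longrightarrow> twist (value_at (f \<otimes>\<^bsub>C_bigr r s\<^esub> g)) hs ks
    = twist (value_at f) hs ks + twist (value_at g) hs ks"
  by (simp add: twist_def value_at_mult additive.add[OF additive_dia_inv])

lemma twist_value_at_one:
  "length hs = r \<Longrightarrow> length ks = s \<Longrightarrow> twist (value_at \<one>\<^bsub>C_bigr r s\<^esub>) hs ks = 0"
  by (simp add: twist_def value_at_one)

text \<open>Merges the components of a total cochain into one twisted function; the length of hs
  selects the component.\<close>

definition total_values :: "nat \<Rightarrow> (nat \<Rightarrow> 'h chain \<Rightarrow> 'i) \<Rightarrow> 'h list \<Rightarrow> 'h list \<Rightarrow> 'i"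
  where "total_values n f hs ks =
    (if ks \<noteq> [] \<and> length hs + length ks = n then twist (value_at (f (length hs))) hs ks else 0)"

lemma C_total_eqI:
  assumes f: "f \<in> carrier (C_total n)" and g: "g \<in> carrier (C_total n)"
    and eq: "\<And>hs ks. ks \<noteq> [] \<Longrightarrow> length hs + length ks = n \<Longrightarrow> total_values n f hs ks = total_values n g hs ks"
  shows "f = g"
proof (rule PiE_ext[of f "{0..<n}" "\<lambda>r. carrier (C_bigr r (n - r))"])
  fix r assume r: "r \<in> {0..<n}"
  show "f r = g r"
  proof (rule C_bigr_eqI)
    show "f r \<in> carrier (C_bigr r (n - r))" "g r \<in> carrier (C_bigr r (n - r))"
      using f g r by (auto simp: carrier_C_total)
    fix hs ks :: "'h list" assume "hs \<in> nz_tuples r" "ks \<in> nz_tuples (n - r)"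
    then have len: "length hs = r" "length ks = n - r" by (auto dest: nz_tuplesD(1))
    then have "ks \<noteq> []" using r by auto
    then have "twist (value_at (f r)) hs ks = twist (value_at (g r)) hs ks"
      using eq[of ks hs] len r by (simp add: total_values_def)
    then show "value_at (f r) hs ks = value_at (g r) hs ks" by (metis dia_twist)
  qed
qed (use f g in \<open>auto simp: carrier_C_total\<close>)

lemma total_diff_component:
  assumes f: "f \<in> carrier (C_total n)" and r: "r \<le> n"
  shows "total_diff dot dia lt n f r \<in> carrier (C_bigr r (n + 1 - r))"
    and "length hs = r \<Longrightarrow> length ks = n + 1 - r \<Longrightarrow>
      twist (value_at (total_diff dot dia lt n f r)) hs ks = full_diff (total_values n f) hs ks"
proof -
  interpret C: comm_group "C_bigr r (n + 1 - r) :: ('h chain \<Rightarrow> 'i) monoid" by (rule comm_group_C_bigr)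
  let ?C = "C_bigr r (n + 1 - r)"
  have fr: "f q \<in> carrier (C_bigr q (n - q))" if "q < n" for q
    using f that by (auto simp: carrier_C_total)
  define A where "A = (if 1 \<le> r then d_hor dot dia (r - 1) (n + 1 - r) (f (r - 1)) else \<one>\<^bsub>?C\<^esub>)"
  define B where "B = (if r < n then d_ver r (n - r) (f r) else \<one>\<^bsub>?C\<^esub>)"
  define E where "E = (if r = n
      then finprod (C_bigr n 1) (\<lambda>k. D_comp dot dia lt (n - k) k (f (n - k))) {1..n} else \<one>\<^bsub>?C\<^esub>)"
  have d: "total_diff dot dia lt n f r = (A \<otimes>\<^bsub>?C\<^esub> B) \<otimes>\<^bsub>?C\<^esub> E"
    using r by (simp add: total_diff_def C_total_def d_total_def D_total_def A_def B_def E_def)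
  have A1: "A \<in> carrier ?C"
  proof (cases r)
    case (Suc q)
    then show ?thesis using d_hor(1)[OF fr[of q]] r by (simp add: A_def)
  next
    case 0
    then show ?thesis using C.one_closed by (simp add: A_def)
  qed
  have B1: "B \<in> carrier ?C"
    using d_ver(1)[OF fr[of r]] C.one_closed by (auto simp: B_def Suc_diff_le)
  have Dk: "D_comp dot dia lt (n - k) k (f (n - k)) \<in> carrier (C_bigr n 1)" if "k \<in> {1..n}" for k
    using D_comp(1)[OF fr[of "n - k"]] that by auto
  have "finprod (C_bigr n 1) (\<lambda>k. D_comp dot dia lt (n - k) k (f (n - k))) {1..n} \<in> carrier (C_bigr n 1)"
    by (rule comm_monoid.finprod_closed[OF comm_group.axioms(1)[OF comm_group_C_bigr]]) (use Dk in blast)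
  then have E1: "E \<in> carrier ?C"
    using C.one_closed by (auto simp: E_def)
  show "total_diff dot dia lt n f r \<in> carrier ?C"
    unfolding d by (rule C.m_closed[OF C.m_closed[OF A1 B1] E1])
  assume len: "length hs = r" "length ks = n + 1 - r"
  have A2: "twist (value_at A) hs ks = hor_diff (total_values n f) hs ks"
  proof (cases r)
    case 0
    then show ?thesis using len twist_value_at_one[OF len] by (simp add: A_def)
  next
    case (Suc q)
    have "twist (value_at A) hs ks = hor_diff (twist (value_at (f q))) hs ks"
      using d_hor(2)[OF fr[of q], of hs ks] len r Suc by (simp add: A_def)
    also have "\<dots> = hor_diff (total_values n f) hs ks"
      by (rule hor_diff_cong) (use len r Suc in \<open>auto simp: total_values_def\<close>)
    finally show ?thesis .
  qed
  have B2: "twist (value_at B) hs ks = ver_diff (total_values n f) hs ks"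
  proof (cases "r < n")
    case True
    have "twist (value_at B) hs ks = ver_diff (twist (value_at (f r))) hs ks"
      using d_ver(2)[OF fr[of r], of hs ks] len True by (simp add: B_def Suc_diff_le)
    also have "\<dots> = ver_diff (total_values n f) hs ks"
      by (rule ver_diff_cong) (use len True in \<open>auto simp: total_values_def\<close>)
    finally show ?thesis .
  next
    case False
    \<comment> \<open>For r = n no vertical component arrives; correspondingly the bar differential
      of a one-letter word is zero.\<close>
    then have "length ks = 1" using len r by simp
    then obtain k where "ks = [k]" by (metis One_nat_def length_0_conv length_Suc_conv)
    then show ?thesis using False twist_value_at_one[OF len] by (simp add: B_def ver_diff_def)
  qed
  have E2: "twist (value_at E) hs ks = edge_diff (total_values n f) hs ks"
  proof (cases "r = n")
    case False
    then have "length ks \<noteq> 1" using len r by auto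
    then show ?thesis using False twist_value_at_one[OF len]
      by (auto simp: E_def edge_diff_def split: list.split)
  next
    case True
    then have "length ks = 1" using len r by simp
    then obtain k where ks: "ks = [k]" by (metis One_nat_def length_0_conv length_Suc_conv)
    let ?w = "\<lambda>j. twist (value_at (f (n - j))) (take (n - j) hs) (drop (n - j) hs)"
    have "twist (value_at E) hs ks
       = dia_inv (sum_list hs) (\<Sum>j\<in>{1..n}. value_at (D_comp dot dia lt (n - j) j (f (n - j))) hs ks)"
      using value_at_finprod[of "{1..n}" "\<lambda>j. D_comp dot dia lt (n - j) j (f (n - j))" n 1 hs ks] Dk len True ks
      by (simp add: E_def twist_def)
    also have "\<dots> = (\<Sum>j\<in>{1..n}. twist (value_at (D_comp dot dia lt (n - j) j (f (n - j)))) hs ks)"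
      by (simp only: additive.sum[OF additive_dia_inv] twist_def)
    also have "\<dots> = (\<Sum>j\<in>{1..n}. alt n (twisted_lt (sum_list hs) k (?w j)))"
    proof (rule sum.cong[OF refl])
      fix j assume j: "j \<in> {1..n}"
      then show "twist (value_at (D_comp dot dia lt (n - j) j (f (n - j)))) hs ks
          = alt n (twisted_lt (sum_list hs) k (?w j))"
        using D_comp(2)[OF fr[of "n - j"], of hs k] len True by (auto simp: ks)
    qed
    also have "\<dots> = alt n (twisted_lt (sum_list hs) k (\<Sum>j\<in>{1..n}. ?w j))"
      by (simp only: additive.sum[OF additive_twisted_lt] alt_sum)
    also have "(\<Sum>j\<in>{1..n}. ?w j) = sum_splits (total_values n f) hs"
      unfolding sum_splits_eq_sum using len True by (intro sum.cong) (auto simp: total_values_def min_def)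
    finally show ?thesis using len True by (simp add: edge_diff_def ks)
  qed
  show "twist (value_at (total_diff dot dia lt n f r)) hs ks = full_diff (total_values n f) hs ks"
    unfolding d twist_value_at_mult[OF len] A2 B2 E2 full_diff_def by (rule refl)
qed

lemma total_diff_carrier:
  assumes f: "f \<in> carrier (C_total n)"
  shows "total_diff dot dia lt n f \<in> carrier (C_total (n + 1))"
  unfolding carrier_C_total
proof (rule PiE_I)
  fix r assume "r \<in> {0..<n + 1}"
  then show "total_diff dot dia lt n f r \<in> carrier (C_bigr r (n + 1 - r))"
    using total_diff_component(1)[OF f, of r] by simp
qed (simp add: total_diff_def C_total_def)

lemma total_values_total_diff:
  assumes f: "f \<in> carrier (C_total n)" and len: "length hs + length ks = n + 1"
  shows "total_values (n + 1) (total_diff dot dia lt n f) hs ks = full_diff (total_values n f) hs ks"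
proof (cases "ks = []")
  case True
  have 0: "total_values m g h [] = 0" for m g h by (simp add: total_values_def)
  show ?thesis using True
    by (cases hs) (simp_all add: full_diff_def ver_diff_def edge_diff_def 0)
next
  case False
  then have "length hs \<le> n" "length ks = n + 1 - length hs" using len by (cases ks; auto)+
  then show ?thesis
    using total_diff_component(2)[OF f, of "length hs" hs ks] False len by (simp add: total_values_def)
qed

lemma total_values_mult:
  assumes "length hs + length ks = n"
  shows "total_values n (f \<otimes>\<^bsub>C_total n\<^esub> g) hs ks = total_values n f hs ks + total_values n g hs ks"
proof (cases "ks = []")
  case False
  then show ?thesis
    using assms twist_value_at_mult[of hs "length hs" ks "n - length hs" "f (length hs)" "g (length hs)"]
    by (auto simp: total_values_def C_total_def)
qed (simp add: total_values_def)

lemma total_values_one: "total_values n \<one>\<^bsub>C_total n\<^esub> hs ks = 0"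
  using twist_value_at_one[of hs "length hs" ks "n - length hs"]
  by (auto simp: total_values_def C_total_def)

lemma total_diff_hom:
  "total_diff dot dia lt n \<in> hom (C_total n) (C_total (n + 1))"
proof (rule homI)
  interpret A: comm_group "C_total n :: (nat \<Rightarrow> 'h chain \<Rightarrow> 'i) monoid" by (rule comm_group_C_total)
  interpret B: comm_group "C_total (n + 1) :: (nat \<Rightarrow> 'h chain \<Rightarrow> 'i) monoid" by (rule comm_group_C_total)
  fix f g :: "nat \<Rightarrow> 'h chain \<Rightarrow> 'i"
  assume f: "f \<in> carrier (C_total n)" and g: "g \<in> carrier (C_total n)"
  show "total_diff dot dia lt n (f \<otimes>\<^bsub>C_total n\<^esub> g)
      = total_diff dot dia lt n f \<otimes>\<^bsub>C_total (n + 1)\<^esub> total_diff dot dia lt n g"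
  proof (rule C_total_eqI[OF total_diff_carrier[OF A.m_closed[OF f g]]
        B.m_closed[OF total_diff_carrier[OF f] total_diff_carrier[OF g]]])
    fix hs ks :: "'h list" assume len: "length hs + length ks = n + 1"
    have "full_diff (total_values n (f \<otimes>\<^bsub>C_total n\<^esub> g)) hs ks
      = full_diff (\<lambda>h k. total_values n f h k + total_values n g h k) hs ks"
      by (rule full_diff_cong) (use len in \<open>auto intro: total_values_mult\<close>)
    then show "total_values (n + 1) (total_diff dot dia lt n (f \<otimes>\<^bsub>C_total n\<^esub> g)) hs ks
      = total_values (n + 1)
          (total_diff dot dia lt n f \<otimes>\<^bsub>C_total (n + 1)\<^esub> total_diff dot dia lt n g) hs ks"
      unfolding total_values_mult[OF len] total_values_total_diff[OF f len] total_values_total_diff[OF g len]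
        total_values_total_diff[OF A.m_closed[OF f g] len] full_diff_add .
  qed
qed (rule total_diff_carrier)

lemma total_diff_total_diff:
  assumes f: "f \<in> carrier (C_total n)"
  shows "total_diff dot dia lt (n + 1) (total_diff dot dia lt n f) = \<one>\<^bsub>C_total (n + 2)\<^esub>"
proof (rule C_total_eqI)
  note df = total_diff_carrier[OF f]
  show "total_diff dot dia lt (n + 1) (total_diff dot dia lt n f) \<in> carrier (C_total (n + 2))"
    using total_diff_carrier[OF df] by simp
  show "\<one>\<^bsub>C_total (n + 2)\<^esub> \<in> carrier (C_total (n + 2) :: (nat \<Rightarrow> 'h chain \<Rightarrow> 'i) monoid)"
    by (rule monoid.one_closed[OF group.is_monoid[OF comm_group.axioms(2)[OF comm_group_C_total]]])
  fix hs ks :: "'h list" assume "length hs + length ks = n + 2"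
  then have len: "length hs + length ks = n + 1 + 1" by simp
  have "total_values (n + 1 + 1) (total_diff dot dia lt (n + 1) (total_diff dot dia lt n f)) hs ks
      = full_diff (total_values (n + 1) (total_diff dot dia lt n f)) hs ks"
    by (rule total_values_total_diff[OF df len])
  also have "\<dots> = full_diff (full_diff (total_values n f)) hs ks"
    by (rule full_diff_cong) (use len in \<open>auto intro!: total_values_total_diff[OF f, simplified]\<close>)
  finally show "total_values (n + 2) (total_diff dot dia lt (n + 1) (total_diff dot dia lt n f)) hs ks
      = total_values (n + 2) \<one>\<^bsub>C_total (n + 2)\<^esub> hs ks"
    by (simp add: full_diff_full_diff total_values_one)
qed

end

theorem theorem6p7:
  fixes dot :: "'h::ab_group_add \<Rightarrow> 'h \<Rightarrow> 'h"
    and dotI :: "'i::ab_group_add \<Rightarrow> 'i \<Rightarrow> 'i"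
    and dia :: "'h \<Rightarrow> 'i \<Rightarrow> 'i"
    and lt :: "'i \<Rightarrow> 'h \<Rightarrow> 'i"
  assumes "linear_cycle_set dot"
    and "trivial_linear_cycle_set dotI"
    and "\<And>h y y'. dia h (y + y') = dia h y + dia h y'"
    and "\<And>y. dia 0 y = y"
    and "\<And>h. lt 0 h = 0"
    and "\<And>y. lt y 0 = 0"
    and "\<And>y h h'. lt y (h + h') = lt y h + lt y h'"
    and "\<And>y y' h. lt (y + y') h = lt y h + lt y' h"
    and "\<And>h h' y. dia (h + h') y = dia (dot h h') (dia h y)"
    and "\<And>h h' y. lt (dia h y) (dot h h') = dia h (lt y h') + lt (dia h (lt y h)) (dot h h')"
    and "\<And>h. bij (\<lambda>y. dia h y)"
  shows "is_cochain_complex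
           (\<lambda>n. C_total n :: (nat \<Rightarrow> 'h chain \<Rightarrow> 'i) monoid)
           (\<lambda>n. total_diff dot dia lt n)"
proof -
  interpret cycle_set_action dot dia lt
    by (intro cycle_set_action.intro cycle_set_action_axioms.intro assms)
  show ?thesis
    unfolding is_cochain_complex_def
    by (intro conjI allI impI ballI comm_group_C_total total_diff_hom total_diff_total_diff)
qed

end
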